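(* Let $b=\pi^2/(12\log 2)$. For any $\varepsilon>0$, we have $$\limsup_{n\to\infty}\frac1n\log\lambda\left\{x\in[0,1):\frac{\log q_n(x)}{n}\ge b+\varepsilon\right\}\le\theta_1(\varepsilon)$$ and $$\liminf_{n\to\infty}\frac1n\log\lambda\left\{x\in[0,1):\frac{\log q_n(x)}{n}\ge b+\varepsilon\right\}\ge-2\log b_\varepsilon-\log 3,$$ where $\theta_1(\varepsilon)=\inf_{0<t<1}\big\{-t(b+\varepsilon)+\mathrm{P}(1-t/2)\big\}<0$ (the negativity being part of the assertion) and $b_\varepsilon$ denotes the smallest integer no less than $e^{b+\varepsilon}$.
   Context: $\lambda$ is Lebesgue measure on $[0,1)$. Every irrational $x\in[0,1)$ has a unique regular continued fraction expansion $x=[a_1(x),a_2(x),\dots]=\cfrac{1}{a_1(x)+\cfrac{1}{a_2(x)+\cdots}}$ with positive integers $a_n(x)$, where $a_1(x)=\lfloor 1/x\rfloor$, $a_{n+1}(x)=a_1(T^n x)$, $T(0)=0$, $T(x)=1/x-\lfloor 1/x\rfloor$ for $x\in(0,1)$. $q_n(x)$ is the denominator of the $n$-th convergent $p_n(x)/q_n(x)=[a_1(x),\dots,a_n(x)]$ in lowest terms; equivalently $q_{-1}=0$, $q_0=1$, $q_n=a_nq_{n-1}+q_{n-2}$. Rational $x$ (finite expansions) form a $\lambda$-null set and may be ignored in the sets measured. For positive integers $a_1,\dots,a_n$, $q_n([a_1,\dots,a_n])$ denotes the denominator given by this recursion. The Diophantine pressure function is, for real $\theta>1/2$, $$\mathrm{P}(\theta)=\lim_{n\to\infty}\frac1n\log\sum_{a_1,\dots,a_n\ge1}q_n^{-2\theta}([a_1,\dots,a_n]),$$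 the sum being over all $n$-tuples of positive integers (the limit exists and is finite for $\theta>1/2$). *)

theory Defs
  imports "HOL-Analysis.Analysis"
begin

definition gauss_map :: "real \<Rightarrow> real" where
  "gauss_map x = (if x = 0 then 0 else 1 / x - of_int \<lfloor>1 / x\<rfloor>)"

text \<open>
  Partial quotients are indexed from 1, so that \<open>cf_digit x (Suc n)\<close> is
  \<open>a\<^sub>1 (T\<^sup>n x)\<close>. The value at index 0 is a dummy.
\<close>

definition cf_digit :: "real \<Rightarrow> nat \<Rightarrow> nat" where
  "cf_digit x n = nat \<lfloor>1 / (gauss_map ^^ (n - 1)) x\<rfloor>"

text \<open>
  \<open>cf_denom a n\<close> is the denominator \<open>q\<^sub>n\<close> of \<open>[a 1, \<dots>, a n]\<close>; the second equation
  is the recursion at index 1 with \<open>q\<close> equal to 0 at index \<open>-1\<close>. It never reads \<open>a 0\<close>.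
\<close>

fun cf_denom :: "(nat \<Rightarrow> nat) \<Rightarrow> nat \<Rightarrow> nat" where
  "cf_denom a 0 = 1"
| "cf_denom a (Suc 0) = a 1"
| "cf_denom a (Suc (Suc n)) = a (Suc (Suc n)) * cf_denom a (Suc n) + cf_denom a n"

text \<open>
  The Diophantine pressure function. For \<open>\<theta> > 1/2\<close> the family is summable and the limit
  exists in the reals; outside that range the value is meaningless.
\<close>

definition dioph_pressure :: "real \<Rightarrow> real" where
  "dioph_pressure \<theta> =
     lim (\<lambda>n. 1 / real n *
       ln (\<Sum>\<^sub>\<infinity>a\<in>({1..n} \<rightarrow>\<^sub>E {1..}). real (cf_denom a n) powr (- 2 * \<theta>)))"

definition levy_const :: real where
  "levy_const = pi\<^sup>2 / (12 * ln 2)"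

definition theta1 :: "real \<Rightarrow> real" where
  "theta1 \<epsilon> = (INF t\<in>{0<..<1}. - t * (levy_const + \<epsilon>) + dioph_pressure (1 - t / 2))"

text \<open>
  Rational points, whose expansions are finite, are left out; they form a null set.
\<close>

definition large_denom_set :: "real \<Rightarrow> nat \<Rightarrow> real set" where
  "large_denom_set \<epsilon> n =
     {x \<in> {0..<1}. x \<notin> \<rat> \<and> ln (real (cf_denom (cf_digit x) n)) / real n \<ge> levy_const + \<epsilon>}"

text \<open>Logarithm on the nonnegative reals with \<open>log 0 = -\<infinity>\<close>, unlike \<open>ln 0 = 0\<close>.\<close>

definition ext_ln :: "real \<Rightarrow> ereal" where
  "ext_ln r = (if r = 0 then -\<infinity> else ereal (ln r))"

definition log_prob_rate :: "real \<Rightarrow> nat \<Rightarrow> ereal" where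
  "log_prob_rate \<epsilon> n = ereal (1 / real n) * ext_ln (measure lebesgue (large_denom_set \<epsilon> n))"

end

theory Submission
  imports Defs "HOL-Real_Asymp.Real_Asymp"
begin

text \<open>
  A cylinder of rank \<open>n\<close> has length comparable to \<open>q\<^sub>n\<close> to the power \<open>-2\<close>, so the upper bound is
  Markov's inequality applied to \<open>q\<^sub>n\<close> to the power \<open>t\<close>, and the lower bound comes from the single
  cylinder all of whose digits equal \<open>b\<^sub>\<epsilon>\<close>. Negativity of \<open>theta1\<close> amounts to
  \<open>P (1 - t / 2) \<le> b t + o(t)\<close> as \<open>t\<close> tends to 0. Here \<open>P (1 - t / 2)\<close> is the logarithm of the growth
  rate of the iterates of a transfer operator, and it is bounded through a supersolution: a first
  order perturbation of the Gauss density. The perturbation is a partial sum of the Neumann series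
  of the cohomological equation; the remainder is small because the normalised operator contracts
  Lipschitz constants by \<open>7 / 8\<close>, and its limit is \<open>b\<close> because the Gauss measure is invariant and
  the integral of \<open>- ln x / (1 + x)\<close> over the unit interval is \<open>\<pi>\<^sup>2 / 12\<close>.
\<close>

section \<open>Convergence of the pressure\<close>

text \<open>For negativity, one small \<open>t\<close> and one positive \<open>h\<close> with
  \<open>L h \<le> \<rho> h\<close> are enough, where \<open>L\<close> is the operator at exponent
  \<open>2 - t\<close>: positivity then gives \<open>P (1 - t / 2) \<le> ln \<rho>\<close>. With
  \<open>h = (1 + t v) / (1 + x)\<close> and \<open>z powr t\<close> expanded to first order, the
  requirement for \<open>\<rho> = 1 + t (b + \<delta>)\<close> is essentially
  \<open>P v + P (- ln) \<le> v + b + \<delta>\<close>, \<open>P\<close> on functions being the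
  Markov operator. A partial Neumann sum \<open>v\<close> fulfils it up to a remainder that
  \<open>\<delta>\<close> absorbs. Two obstacles shape the estimates. The function
  \<open>- ln\<close> is unbounded at 0, so contraction is used only from \<open>P (- ln)\<close>
  on, which is Lipschitz. The second-order remainder of \<open>z powr t\<close> has to be summable
  against weights of order \<open>1 / z^2\<close>, hence the recurring bound by
  \<open>sqrt z\<close>. Moreover, \<open>lim\<close> and \<open>INF\<close> in the definitions
  carry information only once convergence and boundedness below are known. Subadditivity gives the
  former; the lower bound on the probabilities gives the latter.\<close>

lemma fekete:
  fixes a :: "nat \<Rightarrow> real"
  assumes sub: "\<And>m n. a (m + n) \<le> a m + a n"
    and low: "\<And>n. - C * real n \<le> a n"
  shows "convergent (\<lambda>n. a n / real n)"
proof -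
  define L where "L = (INF n\<in>{1..}. a n / real n)"
  have bdd: "bdd_below ((\<lambda>n. a n / real n) ` {1..})"
    using low by (intro bdd_belowI2[of _ "-C"]) (auto simp: field_simps)
  have lower: "L \<le> a n / real n" if "n \<ge> 1" for n
    unfolding L_def using bdd that by (intro cINF_lower) auto
  have mult: "a (k * m) \<le> real k * a m" if "k \<ge> 1" for k m
    using that
  proof (induction k rule: nat_induct_at_least)
    case (Suc k)
    have "a (Suc k * m) \<le> a m + a (k * m)"
      using sub[of m "k * m"] by simp
    with Suc show ?case by (simp add: algebra_simps)
  qed simp
  have "(\<lambda>n. a n / real n) \<longlonglongrightarrow> L"
  proof (rule LIMSEQ_I)
    fix e :: real assume "e > 0"
    then obtain m where m: "m \<ge> 1" "a m / real m < L + e / 2"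
      using cINF_less_iff[OF _ bdd, of "L + e / 2"] unfolding L_def by auto
    define B where "B = Max ((\<lambda>r. \<bar>a r\<bar>) ` {..<m})"
    have B: "\<bar>a r\<bar> \<le> B" if "r < m" for r
      unfolding B_def using that by (intro Max_ge) auto
    have B0: "B \<ge> 0"
      using B[of 0] m by force
    define K where "K = 2 * B + \<bar>a m\<bar>"
    have bound: "a n \<le> real n * (a m / real m) + K" for n
    proof -
      define q r where "q = n div m" and "r = n mod m"
      have n: "n = q * m + r" and r: "r < m"
        using m by (auto simp: q_def r_def)
      \<comment> \<open>For \<open>q = 0\<close> subadditivity gives no upper bound on
        \<open>a 0\<close>; the maximum \<open>B\<close> includes the index 0 and covers this
        case.\<close>
      have "a (q * m) \<le> real q * a m + B"
        using mult[of q m] B0 B[of 0] m by (cases "q = 0") force+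
      then have "a n \<le> real q * a m + B + B"
        using sub[of "q * m" r] B[OF r] unfolding n by linarith
      also have "real q * a m = real n * (a m / real m) - real r / real m * a m"
        unfolding n using m by (simp add: field_simps)
      also have "\<dots> + B + B \<le> real n * (a m / real m) + K"
      proof -
        have "\<bar>real r / real m * a m\<bar> \<le> 1 * \<bar>a m\<bar>"
          unfolding abs_mult using r by (intro mult_right_mono) auto
        then show ?thesis unfolding K_def by linarith
      qed
      finally show ?thesis .
    qed
    obtain N0 :: nat where "real N0 > 2 * K / e"
      using reals_Archimedean2 by blast
    then obtain N where N: "real N > 2 * K / e" "N \<ge> 1"
      by (intro that[of "Suc N0"]) auto
    have "norm (a n / real n - L) < e" if "n \<ge> N" for n
    proof -
      have n: "real n > 2 * K / e" "n \<ge> 1"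
        using that N by (auto intro: less_le_trans)
      have "a n / real n \<le> a m / real m + K / real n"
        using bound[of n] n by (simp add: field_simps)
      also have "K / real n < e / 2"
        using n \<open>e > 0\<close> by (simp add: field_simps)
      finally show ?thesis
        using m(2) lower[OF n(2)] by (simp add: abs_less_iff)
    qed
    then show "\<exists>N. \<forall>n\<ge>N. norm (a n / real n - L) < e" by blast
  qed
  then show ?thesis by (rule convergentI)
qed

section \<open>Sums of powers of the denominators over digit tuples\<close>

definition cf_denom_prev :: "(nat \<Rightarrow> nat) \<Rightarrow> nat \<Rightarrow> nat" where
  "cf_denom_prev a n = (case n of 0 \<Rightarrow> 0 | Suc m \<Rightarrow> cf_denom a m)"

lemma cf_denom_prev_simps [simp]:
  "cf_denom_prev a 0 = 0" "cf_denom_prev a (Suc n) = cf_denom a n"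
  by (simp_all add: cf_denom_prev_def)

lemma cf_denom_Suc: "cf_denom a (Suc n) = a (Suc n) * cf_denom a n + cf_denom_prev a n"
  by (cases n) simp_all

lemma cf_denom_cong: "(\<And>i. i \<in> {1..n} \<Longrightarrow> a i = b i) \<Longrightarrow> cf_denom a n = cf_denom b n"
  by (induction b n rule: cf_denom.induct) simp_all

lemma cf_denom_prev_cong:
  "(\<And>i. i \<in> {1..n} \<Longrightarrow> a i = b i) \<Longrightarrow> cf_denom_prev a n = cf_denom_prev b n"
  by (cases n) (auto intro: cf_denom_cong)

lemma cf_denom_pos: "(\<And>i. i \<in> {1..n} \<Longrightarrow> a i \<ge> 1) \<Longrightarrow> cf_denom a n \<ge> 1"
proof (induction n)
  case (Suc n)
  have "1 * 1 \<le> a (Suc n) * cf_denom a n"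
    using Suc.prems by (intro mult_mono Suc.IH) auto
  then show ?case unfolding cf_denom_Suc by linarith
qed simp

lemma cf_denom_prev_le: "(\<And>i. i \<in> {1..n} \<Longrightarrow> a i \<ge> 1) \<Longrightarrow> cf_denom_prev a n \<le> cf_denom a n"
proof (cases n)
  case (Suc m)
  assume "\<And>i. i \<in> {1..n} \<Longrightarrow> a i \<ge> 1"
  from this[of n] have "1 * cf_denom a m \<le> a n * cf_denom a m"
    by (intro mult_right_mono) (simp_all add: Suc)
  then show ?thesis unfolding Suc cf_denom_Suc cf_denom_prev_simps by linarith
qed simp

text \<open>
  The sum of \<open>q\<^sub>n + x q\<^sub>n\<^sub>-\<^sub>1\<close> to the power \<open>- s\<close> over all digit tuples. The recursion splits off the last
  digit \<open>k + 1\<close>, since \<open>q\<^sub>n\<^sub>+\<^sub>1 + x q\<^sub>n = (k + 1 + x) (q\<^sub>n + q\<^sub>n\<^sub>-\<^sub>1 / (k + 1 + x))\<close>.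
\<close>

primrec denom_sum :: "real \<Rightarrow> nat \<Rightarrow> real \<Rightarrow> real" where
  "denom_sum s 0 x = 1"
| "denom_sum s (Suc n) x =
     (\<Sum>k. (real k + 1 + x) powr (-s) * denom_sum s n (1 / (real k + 1 + x)))"

abbreviation tuples :: "nat \<Rightarrow> (nat \<Rightarrow> nat) set" where
  "tuples n \<equiv> {1..n} \<rightarrow>\<^sub>E {1..}"

lemma summable_powr_shift: "s > 1 \<Longrightarrow> summable (\<lambda>k. (real k + 1) powr (-s))"
  using summable_real_powr_iff[of "-s"] summable_Suc_iff[of "\<lambda>k. real k powr (-s)"]
  by (simp add: add.commute)

lemma bij_betw_tuples_Suc:
  "bij_betw (\<lambda>(k, a). a(Suc n := Suc k)) (UNIV \<times> tuples n) (tuples (Suc n))"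
proof -
  have "bij_betw (\<lambda>(y, a). a(Suc n := y)) ({1..} \<times> tuples n) (tuples (Suc n))"
    unfolding bij_betw_def
    using inj_combinator[of "Suc n" "{1..n}" "\<lambda>_. {1::nat..}"]
      PiE_insert_eq[of "Suc n" "{1..n}" "\<lambda>_. {1::nat..}"]
    by (simp add: atLeastAtMostSuc_conv)
  moreover have "bij_betw (\<lambda>(k, a). (Suc k, a)) (UNIV \<times> tuples n) ({1..} \<times> tuples n)"
    by (rule bij_betwI[where g = "\<lambda>(k, a). (k - 1, a)"]) auto
  ultimately show ?thesis
    using bij_betw_trans by (fastforce simp: o_def case_prod_unfold)
qed

text \<open>Summability is proved along with the value. The terms decrease in \<open>x\<close>, so
  every inner sum is at most the one at 0, and the series over the last digit is dominated by
  \<open>(k + 1) powr (-s)\<close>. Nonnegativity then merges the iterated sums into one.\<close>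

lemma has_sum_denom_sum:
  assumes s: "s > 1" and x: "x \<in> {0..1}"
  shows "((\<lambda>a. (real (cf_denom a n) + x * real (cf_denom_prev a n)) powr (-s))
            has_sum denom_sum s n x) (tuples n)"
  using x
proof (induction n arbitrary: x)
  case 0
  have eq: "tuples 0 = {\<lambda>_. undefined}" by simp
  show ?case unfolding eq by (rule has_sum_finiteI) auto
next
  case (Suc n)
  let ?z = "\<lambda>k. real k + 1 + x"
  let ?t = "\<lambda>a x. (real (cf_denom a n) + x * real (cf_denom_prev a n)) powr (-s)"
  have z: "?z k > 0" "1 / ?z k \<in> {0..1}" for k
    using Suc.prems by (auto simp: field_simps)
  have nonneg: "0 \<le> denom_sum s n y" if "y \<in> {0..1}" for y
    by (rule has_sum_nonneg[OF Suc.IH[OF that]]) simp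
  have le0: "denom_sum s n y \<le> denom_sum s n 0" if "y \<in> {0..1}" for y
  proof (rule has_sum_mono[OF Suc.IH[OF that] Suc.IH])
    fix a assume "a \<in> tuples n"
    then have "cf_denom a n \<ge> 1" by (intro cf_denom_pos) (auto simp: PiE_iff)
    then show "?t a y \<le> ?t a 0"
      using that s by (intro powr_mono2') auto
  qed simp
  have summ: "summable (\<lambda>k. ?z k powr (-s) * denom_sum s n (1 / ?z k))"
  proof (rule summable_comparison_test'[where N = 0])
    show "summable (\<lambda>k. (real k + 1) powr (-s) * denom_sum s n 0)"
      by (intro summable_mult2 summable_powr_shift s)
    fix k :: nat
    have "?z k powr (-s) \<le> (real k + 1) powr (-s)"
      using Suc.prems s by (intro powr_mono2') auto
    then show "norm (?z k powr (-s) * denom_sum s n (1 / ?z k))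
        \<le> (real k + 1) powr (-s) * denom_sum s n 0"
      using le0[OF z(2)[of k]] nonneg[OF z(2)[of k]]
      by (auto simp: abs_mult intro!: mult_mono)
  qed
  then have outer: "((\<lambda>k. ?z k powr (-s) * denom_sum s n (1 / ?z k)) has_sum denom_sum s (Suc n) x) UNIV"
    using nonneg z by (auto intro!: sums_nonneg_imp_has_sum simp: summable_sums)
  let ?f = "\<lambda>(k, a). ?z k powr (-s) * ?t a (1 / ?z k)"
  have inner: "((\<lambda>a. ?f (k, a)) has_sum (?z k powr (-s) * denom_sum s n (1 / ?z k))) (tuples n)" for k
    using has_sum_cmult_right[OF Suc.IH[OF z(2)]] by simp
  have "(?f has_sum denom_sum s (Suc n) x) (UNIV \<times> tuples n)"
  proof (rule has_sum_SigmaI[OF inner outer])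
    show "?f summable_on (UNIV \<times> tuples n)"
      by (rule summable_on_SigmaI[OF inner]) (use outer in \<open>auto simp: summable_on_def\<close>)
  qed
  moreover have "?f (k, a) = (real (cf_denom (a(Suc n := Suc k)) (Suc n))
      + x * real (cf_denom_prev (a(Suc n := Suc k)) (Suc n))) powr (-s)" if "a \<in> tuples n" for k a
  proof -
    have q: "cf_denom (a(Suc n := Suc k)) n = cf_denom a n"
      by (rule cf_denom_cong) auto
    have p: "cf_denom_prev (a(Suc n := Suc k)) n = cf_denom_prev a n"
      by (rule cf_denom_prev_cong) auto
    have "?f (k, a) = (?z k * (real (cf_denom a n) + 1 / ?z k * real (cf_denom_prev a n))) powr (-s)"
      using z[of k] by (simp add: powr_mult)
    also have "?z k * (real (cf_denom a n) + 1 / ?z k * real (cf_denom_prev a n))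
        = ?z k * real (cf_denom a n) + real (cf_denom_prev a n)"
      using z(1)[of k] by (simp add: distrib_left)
    finally show ?thesis
      by (simp add: cf_denom_Suc q p algebra_simps)
  qed
  ultimately have "((\<lambda>p. (real (cf_denom (case p of (k, a) \<Rightarrow> a(Suc n := Suc k)) (Suc n))
      + x * real (cf_denom_prev (case p of (k, a) \<Rightarrow> a(Suc n := Suc k)) (Suc n))) powr (-s))
      has_sum denom_sum s (Suc n) x) (UNIV \<times> tuples n)"
    by (subst has_sum_cong[where g = ?f]) auto
  then show ?case
    using has_sum_reindex_bij_betw[OF bij_betw_tuples_Suc,
        of "\<lambda>a. (real (cf_denom a (Suc n)) + x * real (cf_denom_prev a (Suc n))) powr (-s)"]
    by simp
qed

lemma denom_sum_nonneg: "s > 1 \<Longrightarrow> x \<in> {0..1} \<Longrightarrow> denom_sum s n x \<ge> 0"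
  by (rule has_sum_nonneg[OF has_sum_denom_sum]) auto

lemma denom_sum_le_0:
  assumes "s > 1" "x \<in> {0..1}"
  shows "denom_sum s n x \<le> denom_sum s n 0"
proof (rule has_sum_mono[OF has_sum_denom_sum has_sum_denom_sum])
  fix a assume "a \<in> tuples n"
  then have "cf_denom a n \<ge> 1" by (intro cf_denom_pos) (auto simp: PiE_iff)
  then show "(real (cf_denom a n) + x * real (cf_denom_prev a n)) powr (-s)
      \<le> (real (cf_denom a n) + 0 * real (cf_denom_prev a n)) powr (-s)"
    using assms by (intro powr_mono2') auto
qed (use assms in auto)

lemma summable_denom_sum:
  assumes s: "s > 1" and x: "x \<in> {0..1}"
  shows "summable (\<lambda>k. (real k + 1 + x) powr (-s) * denom_sum s n (1 / (real k + 1 + x)))"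
proof (rule summable_comparison_test'[where N = 0])
  show "summable (\<lambda>k. (real k + 1) powr (-s) * denom_sum s n 0)"
    by (intro summable_mult2 summable_powr_shift s)
  fix k :: nat
  have z: "1 / (real k + 1 + x) \<in> {0..1}"
    using x by (auto simp: field_simps)
  have "(real k + 1 + x) powr (-s) \<le> (real k + 1) powr (-s)"
    using x s by (intro powr_mono2') auto
  then show "norm ((real k + 1 + x) powr (-s) * denom_sum s n (1 / (real k + 1 + x)))
      \<le> (real k + 1) powr (-s) * denom_sum s n 0"
    using denom_sum_le_0[OF s z] denom_sum_nonneg[OF s z]
    by (auto simp: abs_mult intro!: mult_mono)
qed

text \<open>Keeping only digit 1 at each stage costs a factor of at least
  \<open>2 powr (-s)\<close>. This is the linear lower bound that \<open>fekete\<close> asks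
  for.\<close>

lemma denom_sum_ge:
  assumes s: "s > 1" and x: "x \<in> {0..1}"
  shows "2 powr (- s * real n) \<le> denom_sum s n x"
  using x
proof (induction n arbitrary: x)
  case (Suc n)
  let ?f = "\<lambda>k. (real k + 1 + x) powr (-s) * denom_sum s n (1 / (real k + 1 + x))"
  have z: "1 / (real k + 1 + x) \<in> {0..1}" for k
    using Suc.prems by (auto simp: field_simps)
  have "2 powr (-s) * 2 powr (- s * real n) \<le> ?f 0"
    using Suc.prems s Suc.IH[OF z[of 0]] by (intro mult_mono powr_mono2') auto
  also have "\<dots> = (\<Sum>k\<in>{0}. ?f k)" by simp
  also have "\<dots> \<le> denom_sum s (Suc n) x"
    unfolding denom_sum.simps
    by (intro sum_le_suminf summable_denom_sum s Suc.prems ballI mult_nonneg_nonneg denom_sum_nonneg z) auto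
  finally show ?case
    by (simp add: powr_add [symmetric] algebra_simps)
qed simp

lemma denom_sum_pos: "s > 1 \<Longrightarrow> x \<in> {0..1} \<Longrightarrow> denom_sum s n x > 0"
  by (rule less_le_trans[OF _ denom_sum_ge]) auto

text \<open>\<open>denom_sum s n\<close> is the \<open>n\<close>-th iterate of a positive operator
  on the constant 1. Replacing it by its maximum, attained at 0, before applying the other
  \<open>m\<close> iterates gives submultiplicativity, hence subadditivity of the
  logarithms.\<close>

lemma denom_sum_submult:
  assumes s: "s > 1" and x: "x \<in> {0..1}"
  shows "denom_sum s (n + m) x \<le> denom_sum s n 0 * denom_sum s m x"
  using x
proof (induction m arbitrary: x)
  case 0
  then show ?case using denom_sum_le_0[OF s] by simp
next
  case (Suc m)
  let ?z = "\<lambda>k. real k + 1 + x"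
  have z: "1 / ?z k \<in> {0..1}" for k
    using Suc.prems by (auto simp: field_simps)
  have "denom_sum s (n + Suc m) x
      \<le> (\<Sum>k. denom_sum s n 0 * (?z k powr (-s) * denom_sum s m (1 / ?z k)))"
    unfolding add_Suc_right denom_sum.simps
  proof (intro suminf_le summable_mult summable_denom_sum s Suc.prems)
    fix k
    show "?z k powr (-s) * denom_sum s (n + m) (1 / ?z k)
        \<le> denom_sum s n 0 * (?z k powr (-s) * denom_sum s m (1 / ?z k))"
      using mult_left_mono[OF Suc.IH[OF z[of k]], of "?z k powr (-s)"] by (simp add: mult_ac)
  qed
  also have "\<dots> = denom_sum s n 0 * denom_sum s (Suc m) x"
    unfolding denom_sum.simps by (rule suminf_mult[OF summable_denom_sum[OF s Suc.prems]])
  finally show ?case .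
qed

text \<open>Comparison principle: start from \<open>1 \<le> h / c\<close>; the operator is monotone
  and each application multiplies \<open>h\<close> by at most \<open>\<rho>\<close>.\<close>

lemma denom_sum_supersolution:
  assumes s: "s > 1" and c: "c > 0" and \<rho>: "\<rho> \<ge> 0" and x: "x \<in> {0..1}"
    and h: "\<And>x. x \<in> {0..1} \<Longrightarrow> h x \<ge> c"
    and step: "\<And>x. x \<in> {0..1} \<Longrightarrow> \<exists>S. (\<lambda>k. (real k + 1 + x) powr (-s) * h (1 / (real k + 1 + x))) sums S
        \<and> S \<le> \<rho> * h x"
  shows "denom_sum s n x \<le> \<rho> ^ n * h x / c"
  using x
proof (induction n arbitrary: x)
  case 0
  then show ?case using h c by simp
next
  case (Suc n)
  let ?z = "\<lambda>k. real k + 1 + x"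
  have z: "1 / ?z k \<in> {0..1}" for k
    using Suc.prems by (auto simp: field_simps)
  obtain S where S: "(\<lambda>k. ?z k powr (-s) * h (1 / ?z k)) sums S" "S \<le> \<rho> * h x"
    using step[OF Suc.prems] by blast
  have "(\<lambda>k. \<rho> ^ n / c * (?z k powr (-s) * h (1 / ?z k))) sums (\<rho> ^ n / c * S)"
    by (rule sums_mult[OF S(1)])
  moreover have "?z k powr (-s) * denom_sum s n (1 / ?z k)
      \<le> \<rho> ^ n / c * (?z k powr (-s) * h (1 / ?z k))" for k
    using mult_left_mono[OF Suc.IH[OF z[of k]], of "?z k powr (-s)"] by (simp add: mult_ac)
  ultimately have "denom_sum s (Suc n) x \<le> \<rho> ^ n / c * S"
    unfolding denom_sum.simps
    by (intro sums_le[OF _ summable_sums[OF summable_denom_sum[OF s Suc.prems]]])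
  also have "\<dots> \<le> \<rho> ^ n / c * (\<rho> * h x)"
    using S(2) c \<rho> by (intro mult_left_mono) auto
  finally show ?case by (simp add: mult_ac)
qed

lemma has_sum_cf_denom:
  assumes "\<theta> > 1 / 2"
  shows "((\<lambda>a. real (cf_denom a n) powr (- 2 * \<theta>)) has_sum denom_sum (2 * \<theta>) n 0) (tuples n)"
  using has_sum_denom_sum[of "2 * \<theta>" 0 n] assms by simp

text \<open>\<open>dioph_pressure\<close> is given by \<open>lim\<close>, a definite description, so
  its value becomes usable only through the convergence established here.\<close>

lemma tendsto_dioph_pressure:
  assumes \<theta>: "\<theta> > 1 / 2"
  shows "(\<lambda>n. ln (denom_sum (2 * \<theta>) n 0) / real n) \<longlonglongrightarrow> dioph_pressure \<theta>"
proof -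
  let ?a = "\<lambda>n. ln (denom_sum (2 * \<theta>) n 0)"
  have s: "2 * \<theta> > 1" using \<theta> by simp
  note pos = denom_sum_pos[OF s, of 0, simplified]
  have "convergent (\<lambda>n. ?a n / real n)"
  proof (rule fekete)
    fix m n
    have "?a (m + n) \<le> ln (denom_sum (2 * \<theta>) m 0 * denom_sum (2 * \<theta>) n 0)"
      using denom_sum_submult[OF s, of 0 m n] pos by simp
    then show "?a (m + n) \<le> ?a m + ?a n"
      using ln_mult_pos[OF pos pos] by simp
  next
    fix n
    have "ln (2 powr (- (2 * \<theta>) * real n)) \<le> ?a n"
      using denom_sum_ge[OF s, of 0 n] by (intro ln_mono) auto
    then show "- (2 * \<theta> * ln 2) * real n \<le> ?a n"
      by (simp add: ln_powr mult_ac)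
  qed
  moreover have "infsum (\<lambda>a. real (cf_denom a n) powr (- 2 * \<theta>)) (tuples n) = denom_sum (2 * \<theta>) n 0" for n
    by (rule infsumI[OF has_sum_cf_denom[OF \<theta>]])
  then have "dioph_pressure \<theta> = lim (\<lambda>n. ?a n / real n)"
    unfolding dioph_pressure_def by simp
  ultimately show ?thesis
    by (simp add: convergent_LIMSEQ_iff)
qed

section \<open>The Gauss operator\<close>

text \<open>
  The transfer operator at exponent 2 conjugated by its fixed density \<open>1 / (1 + x)\<close>, which makes it
  a Markov operator; the index \<open>k\<close> belongs to the digit \<open>k + 1\<close>.
\<close>

definition gauss_weight :: "nat \<Rightarrow> real \<Rightarrow> real" where
  "gauss_weight k x = (1 + x) / ((real k + 1 + x) * (real k + 2 + x))"

definition gauss_op :: "(real \<Rightarrow> real) \<Rightarrow> real \<Rightarrow> real" where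
  "gauss_op \<phi> x = (\<Sum>k. gauss_weight k x * \<phi> (1 / (real k + 1 + x)))"

lemma branch_unit: "x \<in> {0..1} \<Longrightarrow> 1 / (real k + 1 + x) \<in> {0..1}"
  by (auto simp: field_simps)

lemma gauss_weight_nonneg: "x \<in> {0..1} \<Longrightarrow> gauss_weight k x \<ge> 0"
  by (auto simp: gauss_weight_def)

lemma gauss_weight_telescope:
  assumes "x \<in> {0..1}"
  shows "gauss_weight k x = (1 + x) / (real k + 1 + x) - (1 + x) / (real (Suc k) + 1 + x)"
proof -
  have "real k + 1 + x \<noteq> 0" "real k + 2 + x \<noteq> 0" using assms by auto
  then show ?thesis unfolding gauss_weight_def by (simp add: divide_simps) algebra
qed

lemma gauss_weight_sums:
  assumes x: "x \<in> {0..1}"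
  shows "(\<lambda>k. gauss_weight k x) sums 1"
proof -
  have "(\<lambda>k. (1 + x) / (real k + 1 + x)) \<longlonglongrightarrow> 0"
    by real_asymp
  from telescope_sums'[OF this] show ?thesis
    using x by (simp add: gauss_weight_telescope)
qed

lemma sum_gauss_weight_le: "x \<in> {0..1} \<Longrightarrow> (\<Sum>k<n. gauss_weight k x) \<le> 1"
  using sum_le_suminf[OF sums_summable[OF gauss_weight_sums], of x "{..<n}"]
    sums_unique[OF gauss_weight_sums, of x] gauss_weight_nonneg
  by auto

text \<open>The weights decay like \<open>z powr (-2)\<close>, so even growth of order
  \<open>sqrt z\<close> leaves the summable exponent \<open>- 3 / 2\<close>. This one envelope
  serves both the logarithm and the remainder of \<open>z powr t\<close>.\<close>

lemma gauss_weight_sqrt_le: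
  assumes x: "x \<in> {0..1}"
  shows "gauss_weight k x * sqrt (real k + 1 + x) \<le> 2 * (real k + 1) powr (- 3 / 2)"
proof -
  let ?z = "real k + 1 + x"
  have z: "?z \<ge> 1" using x by auto
  have "gauss_weight k x \<le> 2 / (?z * ?z)"
    unfolding gauss_weight_def using x z by (intro frac_le mult_mono mult_pos_pos) auto
  also have "\<dots> = 2 * ?z powr (-2)"
    using z by (simp add: powr_minus powr_numeral power2_eq_square divide_inverse)
  finally have "gauss_weight k x * sqrt ?z \<le> 2 * ?z powr (-2) * ?z powr (1 / 2)"
    using z by (intro mult_mono) (auto simp: powr_half_sqrt)
  also have "\<dots> = 2 * ?z powr (- 3 / 2)"
    using z by (simp add: powr_add [symmetric])
  also have "\<dots> \<le> 2 * (real k + 1) powr (- 3 / 2)"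
    using x by (intro mult_left_mono powr_mono2') auto
  finally show ?thesis .
qed

lemma summable_three_halves: "summable (\<lambda>k. (real k + 1) powr (- 3 / 2))"
  using summable_powr_shift[of "3 / 2"] by simp

lemma summable_gauss_weight:
  assumes x: "x \<in> {0..1}" and c: "\<And>k. \<bar>c k\<bar> \<le> B * sqrt (real k + 1 + x)"
  shows "summable (\<lambda>k. gauss_weight k x * c k)"
proof (rule summable_comparison_test'[where N = 0])
  show "summable (\<lambda>k. B * (2 * (real k + 1) powr (- 3 / 2)))"
    by (intro summable_mult summable_three_halves)
  have "0 \<le> B * sqrt (real 0 + 1 + x)" using c[of 0] by linarith
  then have B: "B \<ge> 0" using x by (simp add: zero_le_mult_iff)
  fix k
  have "norm (gauss_weight k x * c k) \<le> gauss_weight k x * (B * sqrt (real k + 1 + x))"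
    using c[of k] gauss_weight_nonneg[OF x, of k] by (auto simp: abs_mult intro!: mult_left_mono)
  also have "\<dots> \<le> B * (2 * (real k + 1) powr (- 3 / 2))"
    using mult_left_mono[OF gauss_weight_sqrt_le[OF x, of k] B] by (simp add: mult_ac)
  finally show "norm (gauss_weight k x * c k) \<le> \<dots>" .
qed

lemma summable_gauss_weight_bounded:
  assumes x: "x \<in> {0..1}" and c: "\<And>k. \<bar>c k\<bar> \<le> B"
  shows "summable (\<lambda>k. gauss_weight k x * c k)"
proof (rule summable_gauss_weight[OF x])
  fix k
  have "B * 1 \<le> B * sqrt (real k + 1 + x)"
    using x c[of k] by (intro mult_left_mono) auto
  then show "\<bar>c k\<bar> \<le> B * sqrt (real k + 1 + x)" using c[of k] by linarith
qed

lemma ln_le_2_sqrt: "z > 0 \<Longrightarrow> ln z \<le> 2 * sqrt (z::real)"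
  using ln_less_self[of "sqrt z"] by (simp add: ln_sqrt)

text \<open>
  The change of the weights is handled by Abel summation against their tail sums
  \<open>(1 + x) / (k + 1 + x)\<close>; this produces the \<open>\<beta>\<close>-sum.
\<close>

lemma gauss_op_diff_le:
  assumes x: "x \<in> {0..1}" and y: "y \<in> {0..1}"
    and \<alpha>: "\<And>k. \<bar>\<phi> (1 / (real k + 1 + x)) - \<phi> (1 / (real k + 1 + y))\<bar> \<le> \<alpha> k * \<bar>x - y\<bar>"
    and \<beta>: "\<And>k. \<bar>\<phi> (1 / (real (Suc k) + 1 + y)) - \<phi> (1 / (real k + 1 + y))\<bar> \<le> \<beta> k"
    and S: "\<And>n. (\<Sum>k<Suc n. gauss_weight k x * \<alpha> k)
               + (\<Sum>k<n. \<beta> k * ((real k + 1) / (real k + 2)\<^sup>2)) \<le> S"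
    and summ: "summable (\<lambda>k. gauss_weight k x * \<phi> (1 / (real k + 1 + x)))"
      "summable (\<lambda>k. gauss_weight k y * \<phi> (1 / (real k + 1 + y)))"
    and lim: "(\<lambda>n. \<phi> (1 / (real n + 1 + y)) / (real n + 1)) \<longlonglongrightarrow> 0"
  shows "\<bar>gauss_op \<phi> x - gauss_op \<phi> y\<bar> \<le> S * \<bar>x - y\<bar>"
proof -
  let ?p = "gauss_weight"
  define f g d where "f k = \<phi> (1 / (real k + 1 + x))"
    and "g k = \<phi> (1 / (real k + 1 + y))"
    and "d k = (1 + x) / (real k + 1 + x) - (1 + y) / (real k + 1 + y)" for k
  have d_eq: "d k = real k * (x - y) / ((real k + 1 + x) * (real k + 1 + y))" for k
  proof -
    have "real k + 1 + x \<noteq> 0" "real k + 1 + y \<noteq> 0" using x y by auto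
    then show ?thesis unfolding d_def by (simp add: divide_simps) algebra
  qed
  have d_le: "\<bar>d (Suc k)\<bar> \<le> (real k + 1) / (real k + 2)\<^sup>2 * \<bar>x - y\<bar>" for k
  proof -
    have "(real k + 1) * \<bar>x - y\<bar> / ((real k + 2 + x) * (real k + 2 + y))
        \<le> (real k + 1) * \<bar>x - y\<bar> / ((real k + 2) * (real k + 2))"
      using x y by (intro divide_left_mono mult_mono mult_pos_pos) auto
    moreover have "\<bar>d (Suc k)\<bar> = (real k + 1) * \<bar>x - y\<bar> / ((real k + 2 + x) * (real k + 2 + y))"
      using x y by (simp add: d_eq abs_mult abs_divide add_ac)
    ultimately show ?thesis by (simp add: power2_eq_square)
  qed
  \<comment> \<open>Both tail sums equal 1 at index 0, so \<open>d 0 = 0\<close> and summation by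
    parts has no lower boundary term. The upper one is removed in the limit by the hypothesis
    \<open>lim\<close>.\<close>
  have abel: "(\<Sum>k<Suc n. (d k - d (Suc k)) * g k)
      = (\<Sum>k<n. d (Suc k) * (g (Suc k) - g k)) - d (Suc n) * g n" for n
  proof (induction n)
    case 0
    then show ?case by (simp add: d_eq)
  qed (simp add: algebra_simps)
  have split: "?p k x * f k - ?p k y * g k = ?p k x * (f k - g k) + (d k - d (Suc k)) * g k" for k
  proof -
    have "(a - b) * u - (a' - b') * v = (a - b) * (u - v) + ((a - a') - (b - b')) * v"
      for a b a' b' u v :: real by algebra
    then show ?thesis
      unfolding d_def gauss_weight_telescope[OF x] gauss_weight_telescope[OF y] .
  qed
  have partial: "\<bar>(\<Sum>k<Suc n. ?p k x * f k) - (\<Sum>k<Suc n. ?p k y * g k)\<bar>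
      \<le> S * \<bar>x - y\<bar> + \<bar>g n / (real n + 1)\<bar>" for n
  proof -
    have "(\<Sum>k<Suc n. ?p k x * f k) - (\<Sum>k<Suc n. ?p k y * g k)
        = (\<Sum>k<Suc n. ?p k x * (f k - g k)) + (\<Sum>k<Suc n. (d k - d (Suc k)) * g k)"
      unfolding sum_subtractf[symmetric] sum.distrib[symmetric] split ..
    also have "\<dots> = (\<Sum>k<Suc n. ?p k x * (f k - g k))
        + (\<Sum>k<n. d (Suc k) * (g (Suc k) - g k)) - d (Suc n) * g n"
      unfolding abel by simp
    finally have eq: "(\<Sum>k<Suc n. ?p k x * f k) - (\<Sum>k<Suc n. ?p k y * g k) = \<dots>" .
    have 1: "\<bar>\<Sum>k<Suc n. ?p k x * (f k - g k)\<bar> \<le> (\<Sum>k<Suc n. ?p k x * \<alpha> k) * \<bar>x - y\<bar>"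
      unfolding sum_distrib_right
    proof (rule order_trans[OF sum_abs sum_mono])
      fix k
      show "\<bar>?p k x * (f k - g k)\<bar> \<le> ?p k x * \<alpha> k * \<bar>x - y\<bar>"
        using mult_left_mono[OF \<alpha>[of k] gauss_weight_nonneg[OF x, of k]]
          gauss_weight_nonneg[OF x, of k]
        by (simp add: abs_mult f_def g_def mult_ac)
    qed
    have 2: "\<bar>\<Sum>k<n. d (Suc k) * (g (Suc k) - g k)\<bar>
        \<le> (\<Sum>k<n. \<beta> k * ((real k + 1) / (real k + 2)\<^sup>2)) * \<bar>x - y\<bar>"
      unfolding sum_distrib_right
    proof (rule order_trans[OF sum_abs sum_mono])
      fix k
      have "\<bar>d (Suc k) * (g (Suc k) - g k)\<bar> \<le> ((real k + 1) / (real k + 2)\<^sup>2 * \<bar>x - y\<bar>) * \<beta> k"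
        unfolding abs_mult using d_le[of k] \<beta>[of k] by (intro mult_mono) (auto simp: g_def)
      then show "\<bar>d (Suc k) * (g (Suc k) - g k)\<bar> \<le> \<beta> k * ((real k + 1) / (real k + 2)\<^sup>2) * \<bar>x - y\<bar>"
        by (simp add: mult_ac)
    qed
    have "\<bar>d (Suc n)\<bar> \<le> 1 / (real n + 1)"
    proof -
      have "(real n + 1) / (real n + 2)\<^sup>2 * \<bar>x - y\<bar> \<le> (real n + 1) / (real n + 1)\<^sup>2 * 1"
        using x y by (intro mult_mono frac_le power_mono) auto
      then show ?thesis using d_le[of n] by (simp add: power2_eq_square)
    qed
    then have 3: "\<bar>d (Suc n) * g n\<bar> \<le> \<bar>g n / (real n + 1)\<bar>"
      using mult_right_mono[of "\<bar>d (Suc n)\<bar>" "1 / (real n + 1)" "\<bar>g n\<bar>"] by (simp add: abs_mult)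
    have "((\<Sum>k<Suc n. ?p k x * \<alpha> k) + (\<Sum>k<n. \<beta> k * ((real k + 1) / (real k + 2)\<^sup>2))) * \<bar>x - y\<bar>
        \<le> S * \<bar>x - y\<bar>"
      using S by (intro mult_right_mono) auto
    then show ?thesis unfolding eq using 1 2 3 by (simp only: distrib_right) linarith
  qed
  have sx: "(\<lambda>n. \<Sum>k<Suc n. ?p k x * f k) \<longlonglongrightarrow> gauss_op \<phi> x"
    unfolding gauss_op_def f_def by (intro LIMSEQ_Suc summable_LIMSEQ summ)
  have sy: "(\<lambda>n. \<Sum>k<Suc n. ?p k y * g k) \<longlonglongrightarrow> gauss_op \<phi> y"
    unfolding gauss_op_def g_def by (intro LIMSEQ_Suc summable_LIMSEQ summ)
  have "(\<lambda>n. S * \<bar>x - y\<bar> + \<bar>g n / (real n + 1)\<bar>) \<longlonglongrightarrow> S * \<bar>x - y\<bar> + \<bar>0\<bar>"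
    unfolding g_def by (intro tendsto_intros lim)
  from LIMSEQ_le[OF tendsto_rabs[OF tendsto_diff[OF sx sy]] this] partial
  show ?thesis by auto
qed

section \<open>Contraction of Lipschitz constants\<close>

lemma sum_inverse_cubes_le: "(\<Sum>k<n. 1 / (real k + 2) ^ 3) \<le> 1 / 4"
proof -
  \<comment> \<open>Its differences are reciprocals of products of three consecutive integers, which
    are at most the cube of the middle one.\<close>
  let ?t = "\<lambda>k. 1 / (2 * (real k + 1) * (real k + 2))"
  have "(\<Sum>k<n. 1 / (real k + 2) ^ 3) \<le> (\<Sum>k<n. ?t k - ?t (Suc k))"
  proof (rule sum_mono)
    fix k
    have "?t k - ?t (Suc k) = 1 / ((real k + 1) * (real k + 2) * (real k + 3))"
      by (simp add: divide_simps) (simp add: algebra_simps)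
    moreover have "(real k + 1) * (real k + 2) * (real k + 3) \<le> (real k + 2) ^ 3"
      by (simp add: power3_eq_cube algebra_simps)
    ultimately show "1 / (real k + 2) ^ 3 \<le> ?t k - ?t (Suc k)"
      by (auto intro!: frac_le)
  qed
  also have "\<dots> = ?t 0 - ?t n" by (rule sum_lessThan_telescope')
  also have "\<dots> \<le> 1 / 4" by simp
  finally show ?thesis .
qed

lemma sum_inverse_squares_le: "(\<Sum>k<n. 1 / (real k + 2)\<^sup>2) \<le> 1"
proof -
  let ?t = "\<lambda>k. 1 / (real k + 1)"
  have "(\<Sum>k<n. 1 / (real k + 2)\<^sup>2) \<le> (\<Sum>k<n. ?t k - ?t (Suc k))"
  proof (rule sum_mono)
    fix k
    have "?t k - ?t (Suc k) = 1 / ((real k + 1) * (real k + 2))"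
      by (simp add: divide_simps)
    moreover have "(real k + 1) * (real k + 2) \<le> (real k + 2)\<^sup>2"
      by (simp add: power2_eq_square algebra_simps)
    ultimately show "1 / (real k + 2)\<^sup>2 \<le> ?t k - ?t (Suc k)"
      by (auto intro!: frac_le)
  qed
  also have "\<dots> = ?t 0 - ?t n" by (rule sum_lessThan_telescope')
  also have "\<dots> \<le> 1" by simp
  finally show ?thesis .
qed

text \<open>The factor is at most 1/4 except at \<open>k = 0\<close>, where the excess 3/4 carries a
  weight of at most 1/2. As the weights sum to at most 1, the total is 1/4 + 3/8.\<close>

lemma sum_gauss_weight_squares_le:
  assumes x: "x \<in> {0..1}"
  shows "(\<Sum>k<Suc n. gauss_weight k x * (1 / (real k + 1)\<^sup>2)) \<le> 5 / 8"
proof -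
  have "(\<Sum>k<Suc n. gauss_weight k x * (1 / (real k + 1)\<^sup>2))
      \<le> (\<Sum>k<Suc n. gauss_weight k x * (1 / 4) + (if k = 0 then 3 / 4 * gauss_weight 0 x else 0))"
  proof (rule sum_mono)
    fix k
    show "gauss_weight k x * (1 / (real k + 1)\<^sup>2)
        \<le> gauss_weight k x * (1 / 4) + (if k = 0 then 3 / 4 * gauss_weight 0 x else 0)"
    proof (cases "k = 0")
      case False
      then have "(2::real)\<^sup>2 \<le> (real k + 1)\<^sup>2" by (intro power_mono) auto
      then have "1 / (real k + 1)\<^sup>2 \<le> 1 / 4" by (intro frac_le) auto
      from mult_left_mono[OF this gauss_weight_nonneg[OF x, of k]] False show ?thesis by simp
    qed simp
  qed
  also have "\<dots> = (\<Sum>k<Suc n. gauss_weight k x) * (1 / 4) + 3 / 4 * gauss_weight 0 x"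
    unfolding sum.distrib sum_distrib_right by (simp add: sum.delta)
  also have "\<dots> \<le> 1 * (1 / 4) + 3 / 4 * (1 / 2)"
  proof (intro add_mono mult_right_mono mult_left_mono sum_gauss_weight_le x)
    have "gauss_weight 0 x = 1 / (2 + x)" using x by (auto simp: gauss_weight_def)
    then show "gauss_weight 0 x \<le> 1 / 2" using x by (auto intro!: frac_le)
  qed auto
  finally show ?thesis by simp
qed

lemma lipschitz_unit_bounded:
  fixes \<phi> :: "real \<Rightarrow> real"
  assumes lip: "\<And>x y. x \<in> {0..1} \<Longrightarrow> y \<in> {0..1} \<Longrightarrow> \<bar>\<phi> x - \<phi> y\<bar> \<le> C * \<bar>x - y\<bar>"
    and x: "x \<in> {0..1}"
  shows "\<bar>\<phi> x\<bar> \<le> \<bar>\<phi> 0\<bar> + \<bar>C\<bar>"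
proof -
  have "\<bar>\<phi> x - \<phi> 0\<bar> \<le> C * \<bar>x - 0\<bar>" using x by (intro lip) auto
  also have "\<dots> \<le> \<bar>C\<bar> * 1" using x by (intro mult_mono) auto
  finally show ?thesis by simp
qed

text \<open>7/8 is 5/8 + 1/4. The branches contract by \<open>1 / (k + 1)^2\<close>, which averages
  to 5/8. Consecutive branch points are at most \<open>1 / ((k + 1) (k + 2))\<close> apart, so the
  change of the weights contributes the sum of inverse cubes.\<close>

lemma gauss_op_lipschitz:
  assumes lip: "\<And>x y. x \<in> {0..1} \<Longrightarrow> y \<in> {0..1} \<Longrightarrow> \<bar>\<phi> x - \<phi> y\<bar> \<le> C * \<bar>x - y\<bar>"
    and x: "x \<in> {0..1}" and y: "y \<in> {0..1}"
  shows "\<bar>gauss_op \<phi> x - gauss_op \<phi> y\<bar> \<le> (7 / 8 * C) * \<bar>x - y\<bar>"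
proof (rule gauss_op_diff_le[OF x y])
  have C: "C \<ge> 0" using lip[of 0 1] by simp
  have bdd: "\<bar>\<phi> u\<bar> \<le> \<bar>\<phi> 0\<bar> + \<bar>C\<bar>" if "u \<in> {0..1}" for u
    using lipschitz_unit_bounded[of \<phi> C u] lip that by blast
  show "summable (\<lambda>k. gauss_weight k x * \<phi> (1 / (real k + 1 + x)))"
    "summable (\<lambda>k. gauss_weight k y * \<phi> (1 / (real k + 1 + y)))"
    by (rule summable_gauss_weight_bounded[OF x bdd[OF branch_unit[OF x]]],
        rule summable_gauss_weight_bounded[OF y bdd[OF branch_unit[OF y]]])
  show "\<bar>\<phi> (1 / (real k + 1 + x)) - \<phi> (1 / (real k + 1 + y))\<bar>
      \<le> (C * (1 / (real k + 1)\<^sup>2)) * \<bar>x - y\<bar>" for k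
  proof -
    have nz: "real k + 1 + x > 0" "real k + 1 + y > 0" using x y by auto
    have "1 / (real k + 1 + x) - 1 / (real k + 1 + y) = (y - x) / ((real k + 1 + x) * (real k + 1 + y))"
      using nz by (simp add: divide_simps)
    then have "\<bar>1 / (real k + 1 + x) - 1 / (real k + 1 + y)\<bar> = \<bar>x - y\<bar> / ((real k + 1 + x) * (real k + 1 + y))"
      using nz by (simp add: abs_mult abs_minus_commute)
    also have "\<dots> \<le> \<bar>x - y\<bar> / ((real k + 1) * (real k + 1))"
      using x y nz by (intro divide_left_mono mult_mono mult_pos_pos) auto
    finally have "C * \<bar>1 / (real k + 1 + x) - 1 / (real k + 1 + y)\<bar> \<le> C * (\<bar>x - y\<bar> / (real k + 1)\<^sup>2)"
      using C by (intro mult_left_mono) (auto simp: power2_eq_square)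
    with lip[OF branch_unit[OF x] branch_unit[OF y], of k k] show ?thesis by simp
  qed
  show "\<bar>\<phi> (1 / (real (Suc k) + 1 + y)) - \<phi> (1 / (real k + 1 + y))\<bar>
      \<le> C / ((real k + 1) * (real k + 2))" for k
  proof -
    have nz: "real k + 1 + y > 0" "real k + 2 + y > 0" using y by auto
    have "1 / (real (Suc k) + 1 + y) - 1 / (real k + 1 + y) = - 1 / ((real k + 1 + y) * (real k + 2 + y))"
      using nz by (simp add: divide_simps)
    then have "\<bar>1 / (real (Suc k) + 1 + y) - 1 / (real k + 1 + y)\<bar> = 1 / ((real k + 1 + y) * (real k + 2 + y))"
      using nz by (simp add: abs_mult)
    also have "\<dots> \<le> 1 / ((real k + 1) * (real k + 2))"
      using y nz by (intro divide_left_mono mult_mono mult_pos_pos) auto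
    finally have "C * \<bar>1 / (real (Suc k) + 1 + y) - 1 / (real k + 1 + y)\<bar> \<le> C * (1 / ((real k + 1) * (real k + 2)))"
      using C by (intro mult_left_mono) auto
    with lip[OF branch_unit[OF y] branch_unit[OF y], of "Suc k" k] show ?thesis by simp
  qed
  show "(\<Sum>k<Suc n. gauss_weight k x * (C * (1 / (real k + 1)\<^sup>2)))
      + (\<Sum>k<n. C / ((real k + 1) * (real k + 2)) * ((real k + 1) / (real k + 2)\<^sup>2)) \<le> 7 / 8 * C" for n
  proof -
    have "(\<Sum>k<Suc n. gauss_weight k x * (C * (1 / (real k + 1)\<^sup>2)))
        = C * (\<Sum>k<Suc n. gauss_weight k x * (1 / (real k + 1)\<^sup>2))"
      unfolding sum_distrib_left by (rule sum.cong) auto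
    moreover have "(\<Sum>k<n. C / ((real k + 1) * (real k + 2)) * ((real k + 1) / (real k + 2)\<^sup>2))
        = C * (\<Sum>k<n. 1 / (real k + 2) ^ 3)"
      unfolding sum_distrib_left
      by (intro sum.cong) (auto simp: power2_eq_square power3_eq_cube)
    ultimately show ?thesis
      using mult_left_mono[OF sum_gauss_weight_squares_le[OF x, of n] C]
        mult_left_mono[OF sum_inverse_cubes_le[of n] C] by simp
  qed
  show "(\<lambda>n. \<phi> (1 / (real n + 1 + y)) / (real n + 1)) \<longlonglongrightarrow> 0"
  proof (rule Lim_null_comparison)
    show "(\<lambda>n. (\<bar>\<phi> 0\<bar> + \<bar>C\<bar>) / (real n + 1)) \<longlonglongrightarrow> 0" by real_asymp
    show "\<forall>\<^sub>F n in sequentially. norm (\<phi> (1 / (real n + 1 + y)) / (real n + 1)) \<le> (\<bar>\<phi> 0\<bar> + \<bar>C\<bar>) / (real n + 1)"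
      using bdd[OF branch_unit[OF y]] by (auto intro!: always_eventually divide_right_mono)
  qed
qed

lemma summable_gauss_weight_ln:
  assumes x: "x \<in> {0..1}"
  shows "summable (\<lambda>k. gauss_weight k x * ln (real k + 1 + x))"
proof (rule summable_gauss_weight[OF x])
  fix k
  show "\<bar>ln (real k + 1 + x)\<bar> \<le> 2 * sqrt (real k + 1 + x)"
    using x ln_le_2_sqrt[of "real k + 1 + x"] by auto
qed

lemma gauss_op_ln_eq:
  assumes x: "x \<in> {0..1}"
  shows "gauss_op (\<lambda>u. - ln u) x = (\<Sum>k. gauss_weight k x * ln (real k + 1 + x))"
  using x by (auto simp: gauss_op_def ln_div intro!: suminf_cong)

text \<open>One application of the operator regularises the singularity of \<open>- ln\<close> at 0:
  at the branch points it reads \<open>ln (k + 1 + x)\<close>, which is 1-Lipschitz in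
  \<open>x\<close> and has increments at most \<open>1 / (k + 1)\<close> in \<open>k\<close>. Each
  of the two effects contributes at most 1.\<close>

lemma gauss_op_ln_lipschitz:
  assumes x: "x \<in> {0..1}" and y: "y \<in> {0..1}"
  shows "\<bar>gauss_op (\<lambda>u. - ln u) x - gauss_op (\<lambda>u. - ln u) y\<bar> \<le> 2 * \<bar>x - y\<bar>"
proof (rule gauss_op_diff_le[OF x y])
  have ln_diff: "\<bar>ln u - ln v\<bar> \<le> \<bar>u - v\<bar> / m" if "m > 0" "u \<ge> m" "v \<ge> m" for u v m :: real
  proof -
    have *: "ln u - ln v \<le> \<bar>u - v\<bar> / m" if "u \<ge> m" "v \<ge> m" for u v
    proof -
      have "ln u - ln v \<le> (u - v) / v"
        using that \<open>m > 0\<close> by (intro ln_diff_le) auto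
      also have "\<dots> \<le> \<bar>u - v\<bar> / v" using that \<open>m > 0\<close> by (intro divide_right_mono) auto
      also have "\<dots> \<le> \<bar>u - v\<bar> / m" using that \<open>m > 0\<close> by (intro divide_left_mono) auto
      finally show ?thesis .
    qed
    from *[of u v] *[of v u] that show ?thesis by (auto simp: abs_minus_commute abs_le_iff)
  qed
  have neg_ln: "- ln (1 / (real k + 1 + z)) = ln (real k + 1 + z)" if "z \<in> {0..1}" for z k
    using that by (auto simp: ln_div)
  show "summable (\<lambda>k. gauss_weight k x * - ln (1 / (real k + 1 + x)))"
    "summable (\<lambda>k. gauss_weight k y * - ln (1 / (real k + 1 + y)))"
    unfolding neg_ln[OF x] neg_ln[OF y] by (intro summable_gauss_weight_ln x y)+
  show "\<bar>- ln (1 / (real k + 1 + x)) - - ln (1 / (real k + 1 + y))\<bar> \<le> 1 * \<bar>x - y\<bar>" for k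
    unfolding neg_ln[OF x] neg_ln[OF y] using ln_diff[of 1 "real k + 1 + x" "real k + 1 + y"] x y by simp
  show "\<bar>- ln (1 / (real (Suc k) + 1 + y)) - - ln (1 / (real k + 1 + y))\<bar> \<le> 1 / (real k + 1)" for k
    unfolding neg_ln[OF x] neg_ln[OF y] using ln_diff[of "real k + 1" "real (Suc k) + 1 + y" "real k + 1 + y"] x y by simp
  show "(\<Sum>k<Suc n. gauss_weight k x * 1)
      + (\<Sum>k<n. 1 / (real k + 1) * ((real k + 1) / (real k + 2)\<^sup>2)) \<le> 2" for n
  proof -
    have "(\<Sum>k<n. 1 / (real k + 1) * ((real k + 1) / (real k + 2)\<^sup>2)) = (\<Sum>k<n. 1 / (real k + 2)\<^sup>2)"
      by (intro sum.cong) auto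
    then show ?thesis
      using sum_gauss_weight_le[OF x, of "Suc n"] sum_inverse_squares_le[of n] by simp
  qed
  show "(\<lambda>n. - ln (1 / (real n + 1 + y)) / (real n + 1)) \<longlonglongrightarrow> 0"
    unfolding neg_ln[OF y] by real_asymp
qed

section \<open>Invariance of the Gauss measure\<close>

lemma branch_interior: "x \<in> {0<..<1} \<Longrightarrow> 1 / (real k + 1 + x) \<in> {0<..<1}"
  by (auto simp: field_simps)

text \<open>
  The transferred function has the primitive \<open>\<Sum>k. \<Phi> (1 / (k + 1)) - \<Phi> (1 / (k + 1 + x))\<close>, whose value
  at 1 telescopes.
\<close>

lemma gauss_transfer_has_integral:
  fixes \<Phi> f :: "real \<Rightarrow> real"
  assumes cont: "continuous_on {0..1} \<Phi>"
    and der: "\<And>x. x \<in> {0<..<1} \<Longrightarrow> (\<Phi> has_real_derivative f x) (at x)"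
    and M: "\<And>k x. x \<in> {0<..<1} \<Longrightarrow> \<bar>f (1 / (real k + 1 + x)) / (real k + 1 + x)\<^sup>2\<bar> \<le> M k"
    and sM: "summable M"
  shows "((\<lambda>x. \<Sum>k. f (1 / (real k + 1 + x)) / (real k + 1 + x)\<^sup>2) has_integral (\<Phi> 1 - \<Phi> 0)) {0..1}"
proof -
  define g where "g k x = \<Phi> (1 / (real k + 1)) - \<Phi> (1 / (real k + 1 + x))" for k x
  define g' where "g' k x = f (1 / (real k + 1 + x)) / (real k + 1 + x)\<^sup>2" for k x
  have dg: "(g k has_real_derivative g' k x) (at x)" if x: "x \<in> {0<..<1}" for k x
  proof -
    have z: "real k + 1 + x \<noteq> 0" using x by auto
    have "((\<lambda>x. 1 / (real k + 1 + x)) has_real_derivative (- 1 / (real k + 1 + x)\<^sup>2)) (at x)"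
      using z by (auto intro!: derivative_eq_intros simp: power2_eq_square)
    from DERIV_chain2[OF der[OF branch_interior[OF x]] this]
    have "((\<lambda>x. \<Phi> (1 / (real k + 1)) - \<Phi> (1 / (real k + 1 + x))) has_real_derivative
        0 - f (1 / (real k + 1 + x)) * (- 1 / (real k + 1 + x)\<^sup>2)) (at x)"
      by (intro DERIV_diff DERIV_const)
    then show ?thesis unfolding g_def[abs_def] g'_def by simp
  qed
  have contg: "continuous_on {0..1} (g k)" for k
    unfolding g_def[abs_def]
    by (intro continuous_intros continuous_on_compose2[OF cont]) (auto simp: field_simps)
  have Mnn: "M k \<ge> 0" for k using order_trans[OF abs_ge_zero M[of "1/2" k]] by simp
  \<comment> \<open>\<open>g k\<close> vanishes at 0, so the mean value theorem carries the bound on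
    its derivative over to \<open>g k\<close> on the closed interval.\<close>
  have bound: "norm (g k x) \<le> M k" if x: "x \<in> {0..1}" for k x
  proof (cases "x = 0")
    case True
    then show ?thesis using Mnn by (simp add: g_def)
  next
    case False
    then have "0 < x" using x by auto
    then obtain l z where z: "0 < z" "z < x" "DERIV (g k) z :> l" "g k x - g k 0 = (x - 0) * l"
    proof -
      have "\<exists>l z. 0 < z \<and> z < x \<and> DERIV (g k) z :> l \<and> g k x - g k 0 = (x - 0) * l"
      proof (rule MVT[OF \<open>0 < x\<close>])
        show "continuous_on {0..x} (g k)"
          using x by (intro continuous_on_subset[OF contg]) auto
        show "g k differentiable (at y)" if "0 < y" "y < x" for y
          using dg[of y k] that x by (auto simp: real_differentiable_def)
      qed
      then show ?thesis using that by blast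
    qed
    have "l = g' k z" using DERIV_unique[OF z(3) dg] z x by auto
    moreover have "\<bar>g' k z\<bar> \<le> M k" using M[of z k] z x by (auto simp: g'_def)
    ultimately have "\<bar>x * l\<bar> \<le> 1 * M k"
      unfolding abs_mult using x by (intro mult_mono) auto
    then show ?thesis using z by (simp add: g_def)
  qed
  let ?H = "\<lambda>x. \<Sum>k. g k x"
  have "uniform_limit {0..1} (\<lambda>n x. \<Sum>k<n. g k x) ?H sequentially"
    by (rule Weierstrass_m_test[OF bound sM])
  then have contH: "continuous_on {0..1} ?H"
    by (rule uniform_limit_theorem[rotated]) (auto intro!: always_eventually continuous_on_sum contg)
  have derH: "(?H has_real_derivative (\<Sum>k. g' k x)) (at x)" if x: "x \<in> {0<..<1}" for x
  proof (rule has_field_derivative_series'(2)[of "{0<..<1}"])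
    show "(g n has_real_derivative g' n y) (at y within {0<..<1})" if "y \<in> {0<..<1}" for n y
      using dg[OF that] by (rule has_field_derivative_at_within)
    show "uniformly_convergent_on {0<..<1} (\<lambda>n x. \<Sum>i<n. g' i x)"
      by (rule Weierstrass_m_test'[OF _ sM]) (use M in \<open>auto simp: g'_def\<close>)
    show "summable (\<lambda>n. g n x)"
      by (rule summable_comparison_test'[OF sM, where N = 0]) (use bound x in auto)
  qed (use x in \<open>auto simp: interior_open\<close>)
  have "((\<lambda>x. \<Sum>k. g' k x) has_integral (?H 1 - ?H 0)) {0..1}"
    by (rule fundamental_theorem_of_calculus_interior[OF _ contH])
      (use derH in \<open>auto simp: has_real_derivative_iff_has_vector_derivative\<close>)
  moreover have "?H 0 = 0" by (simp add: g_def)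
  moreover have "?H 1 = \<Phi> 1 - \<Phi> 0"
  proof -
    have "(\<lambda>n. 1 / (real n + 1)) \<longlonglongrightarrow> 0" by real_asymp
    then have "(\<lambda>n. \<Phi> (1 / (real n + 1))) \<longlonglongrightarrow> \<Phi> 0"
      by (intro continuous_on_tendsto_compose[OF cont]) (auto intro!: always_eventually simp: field_simps)
    from sums_unique[OF telescope_sums'[OF this]] show ?thesis by (simp add: g_def add_ac)
  qed
  ultimately show ?thesis by (simp add: g'_def)
qed

section \<open>The dilogarithm and the integral of \<open>- ln x / (1 + x)\<close>\<close>

definition dilog_coeff :: "nat \<Rightarrow> real" where
  "dilog_coeff n = (-1) ^ Suc n / (real n)\<^sup>2"

text \<open>Subtracting twice the even terms of the series for \<open>zeta(2)\<close> halves it, as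
  the even terms make up a quarter. The terms at index 0 vanish by the convention for division by
  zero.\<close>

lemma dilog_coeff_sums: "dilog_coeff sums (pi\<^sup>2 / 12)"
proof -
  have "(\<lambda>n. 1 / (real (Suc n))\<^sup>2) sums (pi\<^sup>2 / 6)"
    using inverse_squares_sums by (simp add: add.commute)
  then have all: "(\<lambda>n. 1 / (real n)\<^sup>2) sums (pi\<^sup>2 / 6)"
    by (subst (asm) sums_Suc_iff) simp
  have "(\<lambda>n. 1 / 4 * (1 / (real n)\<^sup>2)) sums (1 / 4 * (pi\<^sup>2 / 6))"
    by (rule sums_mult[OF all])
  from sums_if[OF sums_zero this]
  have "(\<lambda>n. if even n then 1 / 4 * (1 / (real (n div 2))\<^sup>2) else 0) sums (0 + 1 / 4 * (pi\<^sup>2 / 6))"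
    by simp
  from sums_diff[OF all sums_mult[OF this, of 2]]
  have "(\<lambda>n. 1 / (real n)\<^sup>2 - 2 * (if even n then 1 / 4 * (1 / (real (n div 2))\<^sup>2) else 0)) sums (pi\<^sup>2 / 12)"
    by simp
  moreover have "1 / (real n)\<^sup>2 - 2 * (if even n then 1 / 4 * (1 / (real (n div 2))\<^sup>2) else 0) = dilog_coeff n" for n
    by (cases "n = 0") (auto simp: dilog_coeff_def elim!: evenE simp: power_mult_distrib divide_simps)
  ultimately show ?thesis by simp
qed

text \<open>In standard notation this is \<open>- Li_2 (- u)\<close>.\<close>

definition dilog :: "real \<Rightarrow> real" where
  "dilog u = (\<Sum>n. dilog_coeff n * u ^ n)"

lemma dilog_0: "dilog 0 = 0"
  unfolding dilog_def powser_zero by (simp add: dilog_coeff_def)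

lemma dilog_1: "dilog 1 = pi\<^sup>2 / 12"
  unfolding dilog_def using sums_unique[OF dilog_coeff_sums] by simp

lemma continuous_on_dilog: "continuous_on {0..1} dilog"
proof -
  have "summable (\<lambda>n. 1 / (real n)\<^sup>2)"
    using inverse_power_summable[of 2, where 'a = real] by (simp add: inverse_eq_divide)
  moreover have "norm (dilog_coeff n * u ^ n) \<le> 1 / (real n)\<^sup>2" if "u \<in> {0..1}" for n u
  proof -
    have "norm (dilog_coeff n * u ^ n) = 1 / (real n)\<^sup>2 * u ^ n"
      using that by (simp add: dilog_coeff_def abs_mult power_abs)
    also have "\<dots> \<le> 1 / (real n)\<^sup>2 * 1"
      using that by (intro mult_left_mono power_le_one) auto
    finally show ?thesis by simp
  qed
  ultimately have "uniform_limit {0..1} (\<lambda>n u. \<Sum>k<n. dilog_coeff k * u ^ k) dilog sequentially"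
    unfolding dilog_def[abs_def] by (rule Weierstrass_m_test[rotated])
  then show ?thesis
    by (rule uniform_limit_theorem[rotated]) (auto intro!: always_eventually continuous_intros)
qed

text \<open>Termwise differentiation produces the Mercator series of \<open>ln (1 + u)\<close>
  divided by \<open>u\<close>; convergence at 1 makes it legitimate inside the unit
  interval.\<close>

lemma DERIV_dilog:
  assumes u: "u \<in> {0<..<1}"
  shows "(dilog has_real_derivative ln (1 + u) / u) (at u)"
proof -
  have "(dilog has_real_derivative (\<Sum>n. diffs dilog_coeff n * u ^ n)) (at u)"
    unfolding dilog_def[abs_def]
    by (rule termdiffs_strong[of _ 1]) (use u sums_summable[OF dilog_coeff_sums] in auto)
  moreover have "(\<Sum>n. diffs dilog_coeff n * u ^ n) = ln (1 + u) / u"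
  proof -
    have "(\<lambda>n. - ((- u) ^ n) / real n) sums ln (1 + u)"
      using u by (intro ln_series') auto
    then have "(\<lambda>n. - ((- u) ^ Suc n) / real (Suc n)) sums ln (1 + u)"
      by (subst sums_Suc_iff) simp
    then have "(\<lambda>n. - ((- u) ^ Suc n) / real (Suc n) / u) sums (ln (1 + u) / u)"
      by (rule sums_divide)
    moreover have "- ((- u) ^ Suc n) / real (Suc n) / u = diffs dilog_coeff n * u ^ n" for n
      using u by (simp add: diffs_def dilog_coeff_def power_minus[of u] power2_eq_square divide_simps)
    ultimately show ?thesis by (simp add: sums_iff)
  qed
  ultimately show ?thesis by simp
qed

text \<open>At \<open>0\<close> the formula relies on the convention \<open>ln 0 = 0\<close>, which happens to be the right limit.\<close>

definition log_primitive :: "real \<Rightarrow> real" where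
  "log_primitive u = dilog u - ln u * ln (1 + u)"

lemma continuous_on_log_primitive: "continuous_on {0..1} log_primitive"
proof -
  have "continuous_on {0..1} (\<lambda>u::real. ln u * ln (1 + u))"
    unfolding continuous_on_eq_continuous_within
  proof
    fix u :: real assume u: "u \<in> {0..1}"
    show "continuous (at u within {0..1}) (\<lambda>u. ln u * ln (1 + u))"
    proof (cases "u = 0")
      case False
      then show ?thesis using u by (auto intro!: continuous_intros continuous_within_ln)
    next
      case True
      have "((\<lambda>u::real. ln u * ln (1 + u)) \<longlongrightarrow> 0) (at_right 0)" by real_asymp
      then show ?thesis
        unfolding True by (simp add: continuous_within at_within_Icc_at_right)
    qed
  qed
  then show ?thesis
    unfolding log_primitive_def[abs_def] by (intro continuous_on_diff continuous_on_dilog)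
qed

text \<open>Integration by parts: the derivative of \<open>dilog\<close> cancels the term
  \<open>ln (1 + u) / u\<close> from the product, leaving the logarithm against the Gauss
  density.\<close>

lemma DERIV_log_primitive:
  assumes u: "u \<in> {0<..<1}"
  shows "(log_primitive has_real_derivative - ln u / (1 + u)) (at u)"
proof -
  have "(log_primitive has_real_derivative ln (1 + u) / u - (1 / u * ln (1 + u) + 1 / (1 + u) * ln u)) (at u)"
    unfolding log_primitive_def[abs_def]
    using u by (intro DERIV_diff DERIV_dilog DERIV_mult) (auto intro!: derivative_eq_intros)
  then show ?thesis using u by (simp add: algebra_simps)
qed

text \<open>The conjugation behind the weights: the right-hand side is the density at the branch
  point times the absolute derivative of the branch.\<close>

lemma gauss_weight_div: "x \<in> {0..1} \<Longrightarrow>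
    gauss_weight k x / (1 + x) = 1 / (1 + 1 / (real k + 1 + x)) / (real k + 1 + x)\<^sup>2"
  unfolding gauss_weight_def by (simp add: power2_eq_square divide_simps add_pos_nonneg)

text \<open>Invariance of the Gauss measure, the difference of \<open>\<Phi>\<close> being the
  integral of \<open>\<phi> / (1 + x)\<close>. Working with a primitive, differentiable only in the
  interior, and allowing square root growth along the branches covers both \<open>- ln\<close> and
  Lipschitz functions.\<close>

lemma gauss_op_has_integral:
  fixes \<Phi> \<phi> :: "real \<Rightarrow> real"
  assumes cont: "continuous_on {0..1} \<Phi>"
    and der: "\<And>x. x \<in> {0<..<1} \<Longrightarrow> (\<Phi> has_real_derivative \<phi> x / (1 + x)) (at x)"
    and B: "\<And>k x. x \<in> {0..1} \<Longrightarrow> \<bar>\<phi> (1 / (real k + 1 + x))\<bar> \<le> B * sqrt (real k + 1 + x)"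
  shows "((\<lambda>x. gauss_op \<phi> x / (1 + x)) has_integral (\<Phi> 1 - \<Phi> 0)) {0..1}"
proof -
  let ?z = "\<lambda>k x. real k + 1 + x"
  have B0: "B \<ge> 0" using B[of 0 0] by simp
  have term_eq: "(\<phi> (1 / ?z k x) / (1 + 1 / ?z k x)) / (?z k x)\<^sup>2 = gauss_weight k x * \<phi> (1 / ?z k x) / (1 + x)"
    if x: "x \<in> {0..1}" for k x
    using arg_cong[OF gauss_weight_div[OF x, of k], of "\<lambda>t. t * \<phi> (1 / ?z k x)"] by simp
  have "((\<lambda>x. \<Sum>k. (\<phi> (1 / ?z k x) / (1 + 1 / ?z k x)) / (?z k x)\<^sup>2) has_integral (\<Phi> 1 - \<Phi> 0)) {0..1}"
  proof (rule gauss_transfer_has_integral[OF cont der])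
    show "summable (\<lambda>k. B * (2 * (real k + 1) powr (- 3 / 2)))"
      by (intro summable_mult summable_three_halves)
    fix k and x :: real assume "x \<in> {0<..<1}"
    then have x: "x \<in> {0..1}" by auto
    have "\<bar>gauss_weight k x * \<phi> (1 / ?z k x) / (1 + x)\<bar> = gauss_weight k x * \<bar>\<phi> (1 / ?z k x)\<bar> / (1 + x)"
      using x gauss_weight_nonneg[OF x, of k] by (simp add: abs_mult)
    also have "\<dots> \<le> gauss_weight k x * \<bar>\<phi> (1 / ?z k x)\<bar> / 1"
      using x gauss_weight_nonneg[OF x, of k] by (intro divide_left_mono) auto
    also have "\<dots> \<le> gauss_weight k x * (B * sqrt (?z k x))"
      using mult_left_mono[OF B[OF x] gauss_weight_nonneg[OF x]] by simp
    also have "\<dots> \<le> B * (2 * (real k + 1) powr (- 3 / 2))"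
      using mult_left_mono[OF gauss_weight_sqrt_le[OF x, of k] B0] by (simp add: mult_ac)
    finally show "\<bar>(\<phi> (1 / ?z k x) / (1 + 1 / ?z k x)) / (?z k x)\<^sup>2\<bar> \<le> B * (2 * (real k + 1) powr (- 3 / 2))"
      unfolding term_eq[OF x] .
  qed
  moreover have "(\<Sum>k. (\<phi> (1 / ?z k x) / (1 + 1 / ?z k x)) / (?z k x)\<^sup>2) = gauss_op \<phi> x / (1 + x)"
    if x: "x \<in> {0..1}" for x
    unfolding term_eq[OF x] gauss_op_def
    by (rule suminf_divide[OF summable_gauss_weight[OF x B[OF x]]])
  ultimately show ?thesis
    by (subst has_integral_cong[where g = "\<lambda>x. \<Sum>k. (\<phi> (1 / ?z k x) / (1 + 1 / ?z k x)) / (?z k x)\<^sup>2"]) auto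
qed

lemma gauss_op_ln_has_integral:
  "((\<lambda>x. gauss_op (\<lambda>u. - ln u) x / (1 + x)) has_integral (pi\<^sup>2 / 12)) {0..1}"
proof -
  have "((\<lambda>x. gauss_op (\<lambda>u. - ln u) x / (1 + x)) has_integral (log_primitive 1 - log_primitive 0)) {0..1}"
  proof (rule gauss_op_has_integral[OF continuous_on_log_primitive DERIV_log_primitive])
    fix k and x :: real assume x: "x \<in> {0..1}"
    then show "\<bar>- ln (1 / (real k + 1 + x))\<bar> \<le> 2 * sqrt (real k + 1 + x)"
      using ln_le_2_sqrt[of "real k + 1 + x"] by (auto simp: ln_div)
  qed
  then show ?thesis by (simp add: log_primitive_def dilog_0 dilog_1)
qed

lemma gauss_op_lipschitz_has_integral:
  assumes lip: "\<And>x y. x \<in> {0..1} \<Longrightarrow> y \<in> {0..1} \<Longrightarrow> \<bar>\<phi> x - \<phi> y\<bar> \<le> C * \<bar>x - y\<bar>"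
    and int: "((\<lambda>x. \<phi> x / (1 + x)) has_integral I) {0..1}"
  shows "((\<lambda>x. gauss_op \<phi> x / (1 + x)) has_integral I) {0..1}"
proof -
  have C: "C \<ge> 0" using lip[of 0 1] by simp
  have "C-lipschitz_on {0..1} \<phi>"
    using lip C by (auto intro!: lipschitz_onI simp: dist_real_def)
  then have "continuous_on {0..1} \<phi>" by (rule lipschitz_on_continuous_on)
  then have cont: "continuous_on {0..1} (\<lambda>x. \<phi> x / (1 + x))"
    by (intro continuous_intros) auto
  let ?\<Phi> = "\<lambda>x. integral {0..x} (\<lambda>x. \<phi> x / (1 + x))"
  have "((\<lambda>x. gauss_op \<phi> x / (1 + x)) has_integral (?\<Phi> 1 - ?\<Phi> 0)) {0..1}"
  proof (rule gauss_op_has_integral)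
    show "continuous_on {0..1} ?\<Phi>"
      by (rule indefinite_integral_continuous_1[OF integrable_continuous_real[OF cont]])
    show "(?\<Phi> has_real_derivative \<phi> x / (1 + x)) (at x)" if "x \<in> {0<..<1}" for x
    proof -
      have "(?\<Phi> has_real_derivative \<phi> x / (1 + x)) (at x within {0..1})"
        using that by (intro integral_has_real_derivative cont) auto
      then show ?thesis using that at_within_interior[of x "{0..1}"] by simp
    qed
    fix k and x :: real assume x: "x \<in> {0..1}"
    have "\<bar>\<phi> (1 / (real k + 1 + x))\<bar> \<le> (\<bar>\<phi> 0\<bar> + \<bar>C\<bar>) * 1"
      using lipschitz_unit_bounded[of \<phi> C] lip branch_unit[OF x] by simp
    also have "\<dots> \<le> (\<bar>\<phi> 0\<bar> + \<bar>C\<bar>) * sqrt (real k + 1 + x)"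
      using x by (intro mult_left_mono) auto
    finally show "\<bar>\<phi> (1 / (real k + 1 + x))\<bar> \<le> \<dots>" .
  qed
  moreover have "?\<Phi> 1 = I" using int by (rule integral_unique)
  ultimately show ?thesis by simp
qed

text \<open>The iteration starts from \<open>gauss_op (\<lambda>u. - ln u)\<close> because
  \<open>- ln\<close> itself is not Lipschitz.\<close>

definition mean_log :: "nat \<Rightarrow> real \<Rightarrow> real" where
  "mean_log N = (gauss_op ^^ N) (gauss_op (\<lambda>u. - ln u))"

lemma mean_log_Suc: "mean_log (Suc N) = gauss_op (mean_log N)"
  by (simp add: mean_log_def)

lemma mean_log_lipschitz:
  "x \<in> {0..1} \<Longrightarrow> y \<in> {0..1} \<Longrightarrow> \<bar>mean_log N x - mean_log N y\<bar> \<le> (2 * (7 / 8) ^ N) * \<bar>x - y\<bar>"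
proof (induction N arbitrary: x y)
  case 0
  then show ?case using gauss_op_ln_lipschitz by (simp add: mean_log_def)
next
  case (Suc N)
  then show ?case using gauss_op_lipschitz[OF Suc.IH Suc.prems] by (simp add: mean_log_Suc mult_ac)
qed

lemma mean_log_has_integral: "((\<lambda>x. mean_log N x / (1 + x)) has_integral (pi\<^sup>2 / 12)) {0..1}"
proof (induction N)
  case 0
  then show ?case using gauss_op_ln_has_integral by (simp add: mean_log_def)
next
  case (Suc N)
  then show ?case
    unfolding mean_log_Suc
    by (intro gauss_op_lipschitz_has_integral[where C = "2 * (7 / 8) ^ N"] mean_log_lipschitz)
qed

lemma has_integral_inverse_one_plus: "((\<lambda>x. m / (1 + x)) has_integral (m * ln 2)) {0..1::real}"
proof -
  have "((\<lambda>x. m / (1 + x)) has_integral (m * ln (1 + 1) - m * ln (1 + 0))) {0..1::real}"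
    by (rule fundamental_theorem_of_calculus)
      (auto intro!: derivative_eq_intros simp flip: has_real_derivative_iff_has_vector_derivative)
  then show ?thesis by simp
qed

text \<open>The Lipschitz constant bounds the oscillation on the unit interval, so no value exceeds
  the Gauss average by more than that. The mass \<open>ln 2\<close> of the density turns the
  integral \<open>pi^2 / 12\<close> into the average \<open>levy_const\<close>.\<close>

lemma mean_log_le:
  assumes x: "x \<in> {0..1}"
  shows "mean_log N x \<le> levy_const + 2 * (7 / 8) ^ N"
proof -
  define m where "m = mean_log N x - 2 * (7 / 8) ^ N"
  have "m * ln 2 \<le> pi\<^sup>2 / 12"
  proof (rule has_integral_le[OF has_integral_inverse_one_plus mean_log_has_integral[of N]])
    fix y :: real assume y: "y \<in> {0..1}"
    have "\<bar>mean_log N x - mean_log N y\<bar> \<le> 2 * (7 / 8) ^ N * 1"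
      by (rule order_trans[OF mean_log_lipschitz[OF x y]]) (use x y in \<open>auto intro!: mult_left_mono\<close>)
    then have "m \<le> mean_log N y" by (simp add: m_def)
    then show "m / (1 + y) \<le> mean_log N y / (1 + y)"
      using y by (intro divide_right_mono) auto
  qed
  then have "m \<le> levy_const"
    by (simp add: levy_const_def field_simps)
  then show ?thesis by (simp add: m_def)
qed

section \<open>Perturbation of the Gauss density\<close>

lemma exp_le_quadratic:
  fixes w :: real
  assumes "w \<ge> 0"
  shows "exp w \<le> 1 + w + w\<^sup>2 * exp w"
proof -
  have "(1 - w) * exp w \<le> exp (- w) * exp w"
    using exp_ge_add_one_self[of "- w"] by (intro mult_right_mono) auto
  then have le: "exp w \<le> 1 + w * exp w"
    by (simp add: algebra_simps flip: exp_add)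
  then have "w * exp w \<le> w * (1 + w * exp w)"
    using assms by (rule mult_left_mono)
  with le show ?thesis by (simp add: algebra_simps power2_eq_square)
qed

text \<open>The square of \<open>ln z \<le> 8 * z powr (1 / 8)\<close> gives the constant 64 and the
  exponent 1/4; together with \<open>t \<le> 1 / 4\<close> the total exponent is 1/2, as much as the
  weights are shown to absorb.\<close>

lemma powr_le_quadratic:
  fixes z t :: real
  assumes z: "z \<ge> 1" and t: "0 \<le> t" "t \<le> 1 / 4"
  shows "z powr t \<le> 1 + t * ln z + 64 * t\<^sup>2 * sqrt z"
proof -
  have ln8: "ln z \<le> 8 * z powr (1 / 8)"
    using ln_less_self[of "z powr (1/8)"] z by (simp add: ln_powr)
  have "(ln z)\<^sup>2 * z powr t \<le> (8 * z powr (1 / 8))\<^sup>2 * z powr (1 / 4)"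
    using z t ln8 by (intro mult_mono power_mono powr_mono) auto
  also have "\<dots> = 64 * (z powr (1 / 4) * z powr (1 / 4))"
    using z by (simp add: power_mult_distrib powr_power)
  also have "z powr (1 / 4) * z powr (1 / 4) = sqrt z"
    using z by (simp add: powr_half_sqrt flip: powr_add)
  finally have "t\<^sup>2 * ((ln z)\<^sup>2 * z powr t) \<le> t\<^sup>2 * (64 * sqrt z)"
    by (rule mult_left_mono) simp
  moreover have "z powr t \<le> 1 + t * ln z + (t * ln z)\<^sup>2 * z powr t"
    using exp_le_quadratic[of "t * ln z"] z t by (simp add: powr_def)
  ultimately show ?thesis by (simp add: power_mult_distrib mult_ac)
qed

lemma mean_log_sums:
  assumes x: "x \<in> {0..1}"
  shows "(\<lambda>k. gauss_weight k x * mean_log j (1 / (real k + 1 + x))) sums mean_log (Suc j) x"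
proof -
  have "\<bar>mean_log j (1 / (real k + 1 + x))\<bar> \<le> \<bar>mean_log j 0\<bar> + \<bar>2 * (7 / 8) ^ j\<bar>" for k
    using lipschitz_unit_bounded[of "mean_log j" "2 * (7 / 8) ^ j"] mean_log_lipschitz branch_unit[OF x] by blast
  from summable_sums[OF summable_gauss_weight_bounded[OF x this]] show ?thesis
    by (simp add: mean_log_Suc gauss_op_def)
qed

definition corrector :: "nat \<Rightarrow> real \<Rightarrow> real" where
  "corrector N x = (\<Sum>j<N. mean_log j x - levy_const)"

lemma corrector_bounded:
  obtains V where "V \<ge> 0" "\<And>x. x \<in> {0..1} \<Longrightarrow> \<bar>corrector N x\<bar> \<le> V"
proof
  let ?V = "\<Sum>j<N. \<bar>mean_log j 0\<bar> + \<bar>2 * (7 / 8) ^ j\<bar> + \<bar>levy_const\<bar>"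
  show "?V \<ge> 0" by (intro sum_nonneg) auto
  fix x :: real assume x: "x \<in> {0..1}"
  have *: "\<bar>mean_log j x\<bar> \<le> \<bar>mean_log j 0\<bar> + \<bar>2 * (7 / 8) ^ j\<bar>" for j
    using lipschitz_unit_bounded[of "mean_log j" "2 * (7 / 8) ^ j"] mean_log_lipschitz x by blast
  show "\<bar>corrector N x\<bar> \<le> ?V"
    unfolding corrector_def
  proof (rule order_trans[OF sum_abs sum_mono])
    fix j
    show "\<bar>mean_log j x - levy_const\<bar> \<le> \<bar>mean_log j 0\<bar> + \<bar>2 * (7 / 8) ^ j\<bar> + \<bar>levy_const\<bar>"
      using *[of j] by linarith
  qed
qed

text \<open>The operator shifts the index of \<open>mean_log\<close>, so the sum telescopes up to
  its two end terms.\<close>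

lemma corrector_sums:
  assumes x: "x \<in> {0..1}"
  shows "(\<lambda>k. gauss_weight k x * corrector N (1 / (real k + 1 + x)))
    sums (corrector N x + mean_log N x - mean_log 0 x)"
proof -
  have "(\<lambda>k. \<Sum>j<N. gauss_weight k x * mean_log j (1 / (real k + 1 + x)) - gauss_weight k x * levy_const)
      sums (\<Sum>j<N. mean_log (Suc j) x - 1 * levy_const)"
    by (intro sums_sum sums_diff mean_log_sums sums_mult2 gauss_weight_sums x)
  moreover have "(\<Sum>j<N. mean_log (Suc j) x - 1 * levy_const) = corrector N x + mean_log N x - mean_log 0 x"
    unfolding corrector_def by (induction N) auto
  ultimately show ?thesis
    by (simp add: corrector_def sum_distrib_left right_diff_distrib)
qed

lemma ln_sums_mean_log:
  assumes x: "x \<in> {0..1}"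
  shows "(\<lambda>k. gauss_weight k x * ln (real k + 1 + x)) sums mean_log 0 x"
  using summable_sums[OF summable_gauss_weight_ln[OF x]] gauss_op_ln_eq[OF x]
  by (simp add: mean_log_def)

lemma levy_const_pos: "levy_const > 0"
  by (simp add: levy_const_def)

text \<open>
  \<open>1 / (1 + x)\<close> is the fixed density of the transfer operator at exponent 2. Correcting it to
  first order in \<open>t\<close> by an approximate solution \<open>v\<close> of the cohomological equation
  \<open>v - P v = P (- ln) - levy_const\<close> makes it a supersolution at exponent \<open>2 - t\<close>.
\<close>

lemma perturbed_density_supersolution:
  assumes t: "0 < t" "t \<le> 1 / 4" and V: "V \<ge> 0" "\<And>x. x \<in> {0..1} \<Longrightarrow> \<bar>corrector N x\<bar> \<le> V"
    and tV: "t * V \<le> 1 / 2" and \<delta>: "\<delta> > 0" and N: "2 * (7 / 8) ^ N \<le> \<delta> / 2"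
    and K: "K = (\<Sum>k. 2 * (real k + 1) powr (- 3 / 2))"
    and small: "t * ((2 * V + 96) * K + V * (levy_const + \<delta>)) \<le> \<delta> / 2"
    and h: "h = (\<lambda>x. (1 + t * corrector N x) / (1 + x))" and x: "x \<in> {0..1}"
  shows "\<exists>S. (\<lambda>k. (real k + 1 + x) powr (-(2 - t)) * h (1 / (real k + 1 + x))) sums S
        \<and> S \<le> (1 + t * (levy_const + \<delta>)) * h x"
proof -
  let ?z = "\<lambda>k. real k + 1 + x"
  let ?p = "\<lambda>k. gauss_weight k x"
  let ?v = "corrector N"
  have z: "?z k \<ge> 1" for k using x by auto
  have tv: "\<bar>t * ?v y\<bar> \<le> 1 / 2" if "y \<in> {0..1}" for y
  proof -
    have "\<bar>t * ?v y\<bar> \<le> t * V"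
      using V(2)[OF that] t by (simp add: abs_mult)
    then show ?thesis using tV by simp
  qed
  have term_eq: "?z k powr (-(2 - t)) * h (1 / ?z k) = ?p k * (?z k powr t * (1 + t * ?v (1 / ?z k))) / (1 + x)" for k
  proof -
    have "?z k powr (-(2 - t)) = ?z k powr t / (?z k)\<^sup>2"
      using z[of k] powr_diff[of "?z k" t 2] by (simp add: powr_numeral)
    moreover have "?p k / (1 + x) = 1 / (1 + 1 / ?z k) / (?z k)\<^sup>2"
      by (rule gauss_weight_div[OF x])
    moreover have "?p k * (?z k powr t * (1 + t * ?v (1 / ?z k))) / (1 + x)
        = ?p k / (1 + x) * (?z k powr t * (1 + t * ?v (1 / ?z k)))" by simp
    ultimately show ?thesis unfolding h by (simp add: mult_ac)
  qed
  \<comment> \<open>Second-order terms: \<open>2 * V\<close> bounds the cross term through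
    \<open>ln z \<le> 2 * sqrt z\<close>, and 96 is 64 times the bound 3/2 on
    \<open>1 + t * v\<close>.\<close>
  let ?u = "\<lambda>k. ?p k + t * (?p k * ?v (1 / ?z k)) + t * (?p k * ln (?z k))
      + t\<^sup>2 * (2 * V + 96) * (2 * (real k + 1) powr (- 3 / 2))"
  have upper: "?p k * (?z k powr t * (1 + t * ?v (1 / ?z k))) \<le> ?u k" for k
  proof -
    define v where "v = ?v (1 / ?z k)"
    have v: "\<bar>t * v\<bar> \<le> 1 / 2" "\<bar>v\<bar> \<le> V"
      using tv[OF branch_unit[OF x]] V(2)[OF branch_unit[OF x]] by (simp_all add: v_def)
    have ln0: "ln (?z k) \<ge> 0" "ln (?z k) \<le> 2 * sqrt (?z k)"
      using z[of k] ln_le_2_sqrt[of "?z k"] by auto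
    have "?z k powr t * (1 + t * v) \<le> (1 + t * ln (?z k) + 64 * t\<^sup>2 * sqrt (?z k)) * (1 + t * v)"
      using powr_le_quadratic[OF z, of t k] t v by (intro mult_right_mono) auto
    also have "\<dots> = 1 + t * v + t * ln (?z k) + t\<^sup>2 * (v * ln (?z k)) + t\<^sup>2 * (64 * sqrt (?z k) * (1 + t * v))"
      by (simp add: algebra_simps power2_eq_square)
    also have "\<dots> \<le> 1 + t * v + t * ln (?z k) + t\<^sup>2 * (V * (2 * sqrt (?z k))) + t\<^sup>2 * (64 * sqrt (?z k) * (3 / 2))"
      using v ln0 V(1) z[of k] by (intro add_mono mult_left_mono order_refl mult_mono) auto
    also have "\<dots> = 1 + t * v + t * ln (?z k) + t\<^sup>2 * (2 * V + 96) * sqrt (?z k)"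
      by (simp add: algebra_simps)
    finally have "?p k * (?z k powr t * (1 + t * v)) \<le> ?p k * \<dots>"
      using gauss_weight_nonneg[OF x] by (rule mult_left_mono)
    also have "\<dots> = ?p k + t * (?p k * v) + t * (?p k * ln (?z k)) + t\<^sup>2 * (2 * V + 96) * (?p k * sqrt (?z k))"
      by (simp add: algebra_simps)
    also have "\<dots> \<le> ?p k + t * (?p k * v) + t * (?p k * ln (?z k)) + t\<^sup>2 * (2 * V + 96) * (2 * (real k + 1) powr (- 3 / 2))"
      using V(1) by (intro add_left_mono mult_left_mono gauss_weight_sqrt_le x) auto
    finally show ?thesis unfolding v_def .
  qed
  have lower: "0 \<le> ?p k * (?z k powr t * (1 + t * ?v (1 / ?z k)))" for k
    using gauss_weight_nonneg[OF x] tv[OF branch_unit[OF x], of k] by (intro mult_nonneg_nonneg) auto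
  \<comment> \<open>The logarithms sum to \<open>mean_log 0 x\<close>, which cancels the negative
    end term left by the corrector. Only \<open>mean_log N x\<close> survives at first order besides
    the corrector.\<close>
  have usum: "?u sums (1 + t * (?v x + mean_log N x - mean_log 0 x) + t * mean_log 0 x + t\<^sup>2 * (2 * V + 96) * K)"
    unfolding K
    by (intro sums_add sums_mult gauss_weight_sums corrector_sums ln_sums_mean_log x summable_sums
        summable_mult summable_three_halves)
  have summ: "summable (\<lambda>k. ?p k * (?z k powr t * (1 + t * ?v (1 / ?z k))))"
    by (rule summable_comparison_test'[OF sums_summable[OF usum], where N = 0])
      (use upper lower in auto)
  let ?S = "\<Sum>k. ?p k * (?z k powr t * (1 + t * ?v (1 / ?z k)))"
  have "?S \<le> 1 + t * ?v x + t * mean_log N x + t\<^sup>2 * (2 * V + 96) * K"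
    using sums_le[OF upper summable_sums[OF summ] usum] by (simp add: algebra_simps)
  also have "\<dots> \<le> 1 + t * ?v x + t * (levy_const + \<delta> / 2) + t\<^sup>2 * (2 * V + 96) * K"
    using mean_log_le[OF x, of N] N t by (intro add_right_mono add_left_mono mult_left_mono) auto
  \<comment> \<open>The right side exceeds the left by \<open>t * \<delta> / 2\<close> up to terms
    of order \<open>t^2\<close>; \<open>small\<close> says that this slack covers them.\<close>
  also have "\<dots> \<le> (1 + t * (levy_const + \<delta>)) * (1 + t * ?v x)"
  proof -
    have "t * ((2 * V + 96) * K) + t * (V * (levy_const + \<delta>)) \<le> \<delta> / 2"
      using small by (simp add: algebra_simps)
    moreover have "t * (V * (levy_const + \<delta>)) \<ge> t * (- ?v x * (levy_const + \<delta>))"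
      using V(2)[OF x] t levy_const_pos \<delta> by (intro mult_left_mono mult_right_mono) auto
    ultimately have "t * ((2 * V + 96) * K) \<le> \<delta> / 2 + t * (?v x * (levy_const + \<delta>))"
      by simp
    from mult_left_mono[OF this, of t] t show ?thesis
      by (simp add: algebra_simps power2_eq_square)
  qed
  finally have "?S / (1 + x) \<le> (1 + t * (levy_const + \<delta>)) * h x"
    using x unfolding h by (simp add: divide_right_mono)
  moreover have "(\<lambda>k. ?z k powr (-(2 - t)) * h (1 / ?z k)) sums (?S / (1 + x))"
    unfolding term_eq by (intro sums_divide summable_sums summ)
  ultimately show ?thesis by blast
qed

text \<open>The choices are nested: \<open>\<delta>\<close> fixes \<open>N\<close>, which fixes the
  bound \<open>V\<close> and the constant \<open>D\<close>, and \<open>t\<close> is taken small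
  last.\<close>

lemma dioph_pressure_le:
  assumes \<delta>: "\<delta> > 0"
  obtains t where "t \<in> {0<..<1}" "dioph_pressure (1 - t / 2) \<le> t * (levy_const + \<delta>)"
proof -
  have "(\<lambda>N. 2 * (7 / 8 :: real) ^ N) \<longlonglongrightarrow> 0" by real_asymp
  then have "eventually (\<lambda>N. 2 * (7 / 8 :: real) ^ N < \<delta> / 2) sequentially"
    using \<delta> by (intro order_tendstoD(2)[where y = 0]) auto
  then obtain N where N: "2 * (7 / 8 :: real) ^ N \<le> \<delta> / 2"
    using eventually_sequentially by (meson less_imp_le order_refl)
  obtain V where V: "V \<ge> 0" "\<And>x. x \<in> {0..1} \<Longrightarrow> \<bar>corrector N x\<bar> \<le> V"
    using corrector_bounded[of N] by blast
  define K where "K = (\<Sum>k. 2 * (real k + 1) powr (- 3 / 2))"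
  have K0: "K \<ge> 0" unfolding K_def by (intro suminf_nonneg summable_mult summable_three_halves) auto
  define D where "D = (2 * V + 96) * K + V * (levy_const + \<delta>)"
  have D0: "D \<ge> 0" unfolding D_def using K0 V levy_const_pos \<delta> by auto
  \<comment> \<open>The three bounds serve the quadratic expansion, the positivity of
    \<open>h\<close>, and the smallness of the second-order terms.\<close>
  define t where "t = min (1 / 4) (min (1 / (2 * (V + 1))) (\<delta> / (2 * (D + 1))))"
  have t: "0 < t" "t \<le> 1 / 4"
    using V D0 \<delta> unfolding t_def by simp (rule min.cobounded1)
  have tV: "t * V \<le> 1 / 2"
  proof -
    have "t * V \<le> 1 / (2 * (V + 1)) * V" using V by (intro mult_right_mono) (auto simp: t_def)
    also have "\<dots> \<le> 1 / 2" using V by (simp add: field_simps)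
    finally show ?thesis .
  qed
  have tD: "t * D \<le> \<delta> / 2"
  proof -
    have "t * D \<le> \<delta> / (2 * (D + 1)) * D" using D0 by (intro mult_right_mono) (auto simp: t_def)
    also have "\<dots> \<le> \<delta> / 2" using D0 \<delta> by (simp add: field_simps)
    finally show ?thesis .
  qed
  define h where "h = (\<lambda>x. (1 + t * corrector N x) / (1 + x))"
  define \<rho> where "\<rho> = 1 + t * (levy_const + \<delta>)"
  have \<rho>: "\<rho> > 0" unfolding \<rho>_def using t levy_const_pos \<delta> by (intro add_pos_nonneg mult_nonneg_nonneg) auto
  have h_ge: "h x \<ge> 1 / 4" if x: "x \<in> {0..1}" for x
  proof -
    have "\<bar>t * corrector N x\<bar> \<le> t * V" using V(2)[OF x] t by (simp add: abs_mult)
    then have "1 / 2 / 2 \<le> h x"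
      unfolding h_def using tV x by (intro frac_le) auto
    then show ?thesis by simp
  qed
  have s: "2 - t > 1" using t by simp
  have s2: "2 * (1 - t / 2) = 2 - t" by simp
  have bound: "denom_sum (2 - t) n 0 \<le> \<rho> ^ n * h 0 / (1 / 4)" for n
  proof (rule denom_sum_supersolution[OF s _ _ _ h_ge])
    fix x :: real assume x: "x \<in> {0..1}"
    show "\<exists>S. (\<lambda>k. (real k + 1 + x) powr (-(2 - t)) * h (1 / (real k + 1 + x))) sums S \<and> S \<le> \<rho> * h x"
      unfolding \<rho>_def
      by (rule perturbed_density_supersolution[OF t V tV \<delta> N K_def tD[unfolded D_def] h_def x])
  qed (use \<rho> in auto)
  have h0: "h 0 > 0" using h_ge[of 0] by simp
  have "dioph_pressure (1 - t / 2) \<le> ln \<rho>"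
  proof (rule LIMSEQ_le)
    show "(\<lambda>n. ln (denom_sum (2 * (1 - t / 2)) n 0) / real n) \<longlonglongrightarrow> dioph_pressure (1 - t / 2)"
      by (rule tendsto_dioph_pressure) (use t in simp)
    show "(\<lambda>n. ln \<rho> + ln (4 * h 0) / real n) \<longlonglongrightarrow> ln \<rho>" by real_asymp
    show "\<exists>N. \<forall>n\<ge>N. ln (denom_sum (2 * (1 - t / 2)) n 0) / real n \<le> ln \<rho> + ln (4 * h 0) / real n"
    proof (intro exI[of _ 1] allI impI)
      fix n :: nat assume n: "n \<ge> 1"
      have "ln (denom_sum (2 - t) n 0) \<le> ln (\<rho> ^ n * (4 * h 0))"
        using bound[of n] denom_sum_pos[OF s, of 0 n] by (intro ln_mono) (auto simp: mult_ac)
      also have "\<dots> = real n * ln \<rho> + ln (4 * h 0)"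
        using \<rho> h0 by (simp add: ln_mult_pos ln_realpow)
      finally show "ln (denom_sum (2 * (1 - t / 2)) n 0) / real n \<le> ln \<rho> + ln (4 * h 0) / real n"
        unfolding s2 using n by (simp add: field_simps)
    qed
  qed
  also have "ln \<rho> \<le> t * (levy_const + \<delta>)"
    unfolding \<rho>_def using t levy_const_pos \<delta> by (intro ln_add_one_self_le_self) auto
  finally show ?thesis using t by (intro that) auto
qed

section \<open>Cylinders\<close>

text \<open>The inverse branch \<open>[a 1, ..., a n + u]\<close> of the \<open>n\<close>-th iterate
  of the Gauss map. Peeling off the last digit matches the recursion of
  \<open>cf_denom\<close>.\<close>

primrec cf_branch :: "(nat \<Rightarrow> nat) \<Rightarrow> nat \<Rightarrow> real \<Rightarrow> real" where
  "cf_branch a 0 u = u"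
| "cf_branch a (Suc n) u = cf_branch a n (1 / (real (a (Suc n)) + u))"

lemma cf_branch_cong: "(\<And>i. i \<in> {1..n} \<Longrightarrow> a i = b i) \<Longrightarrow> cf_branch a n u = cf_branch b n u"
  by (induction n arbitrary: u) auto

text \<open>This takes the place of the determinant identity for convergents, in a form where
  numerators never appear. In the induction the factors \<open>m + u\<close> and
  \<open>m + v\<close> coming from the last digit turn the old denominators into the new
  ones.\<close>

lemma cf_branch_diff:
  assumes "\<And>i. i \<in> {1..n} \<Longrightarrow> a i \<ge> 1" and "u \<in> {0..1}" and "v \<in> {0..1}"
  shows "\<bar>cf_branch a n u - cf_branch a n v\<bar> = \<bar>u - v\<bar> /
    ((real (cf_denom a n) + u * real (cf_denom_prev a n)) * (real (cf_denom a n) + v * real (cf_denom_prev a n)))"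
  using assms
proof (induction n arbitrary: u v)
  case (Suc n)
  define m where "m = real (a (Suc n))"
  have m: "m \<ge> 1" using Suc.prems(1)[of "Suc n"] by (simp add: m_def)
  have pos: "m + u > 0" "m + v > 0" using m Suc.prems by auto
  have unit: "1 / (m + u) \<in> {0..1}" "1 / (m + v) \<in> {0..1}"
    using m Suc.prems by (auto simp: divide_simps)
  let ?q = "real (cf_denom a n)" and ?p = "real (cf_denom_prev a n)"
  have "\<bar>cf_branch a (Suc n) u - cf_branch a (Suc n) v\<bar>
      = \<bar>1 / (m + u) - 1 / (m + v)\<bar> / ((?q + 1 / (m + u) * ?p) * (?q + 1 / (m + v) * ?p))"
    using Suc.IH[OF Suc.prems(1) unit] by (simp add: m_def)
  also have "\<bar>1 / (m + u) - 1 / (m + v)\<bar> = \<bar>u - v\<bar> / ((m + u) * (m + v))"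
  proof -
    have "1 / (m + u) - 1 / (m + v) = (v - u) / ((m + u) * (m + v))"
      using pos by (simp add: divide_simps)
    then show ?thesis using pos by (simp add: abs_mult abs_minus_commute)
  qed
  also have "\<bar>u - v\<bar> / ((m + u) * (m + v)) / ((?q + 1 / (m + u) * ?p) * (?q + 1 / (m + v) * ?p))
      = \<bar>u - v\<bar> / (((m + u) * (?q + 1 / (m + u) * ?p)) * ((m + v) * (?q + 1 / (m + v) * ?p)))"
    by (simp add: mult_ac)
  also have "(m + u) * (?q + 1 / (m + u) * ?p) = real (cf_denom a (Suc n)) + u * real (cf_denom_prev a (Suc n))"
  proof -
    have "(m + u) * (?q + 1 / (m + u) * ?p) = (m + u) * ?q + ?p"
      using pos by (simp add: distrib_left)
    then show ?thesis by (simp add: cf_denom_Suc m_def distrib_right)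
  qed
  also have "(m + v) * (?q + 1 / (m + v) * ?p) = real (cf_denom a (Suc n)) + v * real (cf_denom_prev a (Suc n))"
  proof -
    have "(m + v) * (?q + 1 / (m + v) * ?p) = (m + v) * ?q + ?p"
      using pos by (simp add: distrib_left)
    then show ?thesis by (simp add: cf_denom_Suc m_def distrib_right)
  qed
  finally show ?case .
qed simp

lemma cf_branch_diff_le:
  assumes a: "\<And>i. i \<in> {1..n} \<Longrightarrow> a i \<ge> 1" and u: "u \<in> {0..1}" and v: "v \<in> {0..1}"
  shows "\<bar>cf_branch a n u - cf_branch a n v\<bar> \<le> \<bar>u - v\<bar> / (real (cf_denom a n))\<^sup>2"
proof -
  have "cf_denom a n \<ge> 1" using cf_denom_pos[of n a] a by simp
  moreover have "\<bar>cf_branch a n u - cf_branch a n v\<bar> = \<bar>u - v\<bar> /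
      ((real (cf_denom a n) + u * real (cf_denom_prev a n)) * (real (cf_denom a n) + v * real (cf_denom_prev a n)))"
    by (rule cf_branch_diff) (use a u v in auto)
  moreover have "\<bar>u - v\<bar> / ((real (cf_denom a n) + u * real (cf_denom_prev a n)) * (real (cf_denom a n) + v * real (cf_denom_prev a n)))
      \<le> \<bar>u - v\<bar> / (real (cf_denom a n) * real (cf_denom a n))"
    using calculation(1) u v by (intro divide_left_mono mult_mono mult_pos_pos add_pos_nonneg) auto
  ultimately show ?thesis
    by (simp only: power2_eq_square)
qed

lemma cf_branch_Rats: "u \<in> \<rat> \<Longrightarrow> cf_branch a n u \<in> \<rat>"
  by (induction n arbitrary: u) auto

definition irrat :: "real set" where
  "irrat = {0<..<1} - \<rat>"

lemma irrat_eq: "irrat = {x \<in> {0..<1}. x \<notin> \<rat>}"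
proof -
  have "x \<noteq> 0" if "x \<notin> \<rat>" for x :: real using that by auto
  then show ?thesis by (force simp: irrat_def)
qed

lemma irratI: "x \<in> {0..<1} \<Longrightarrow> x \<notin> \<rat> \<Longrightarrow> x \<in> irrat"
  by (simp add: irrat_eq)

lemma gauss_map_irrat:
  assumes "x \<in> irrat"
  shows "gauss_map x \<in> irrat" "nat \<lfloor>1 / x\<rfloor> \<ge> 1" "x = 1 / (real (nat \<lfloor>1 / x\<rfloor>) + gauss_map x)"
proof -
  have x: "0 < x" "x < 1" "x \<notin> \<rat>" using assms by (auto simp: irrat_def)
  have eq: "gauss_map x = 1 / x - of_int \<lfloor>1 / x\<rfloor>" using x by (simp add: gauss_map_def)
  have "gauss_map x \<notin> \<rat>"
  proof
    assume "gauss_map x \<in> \<rat>"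
    then have "gauss_map x + of_int \<lfloor>1 / x\<rfloor> \<in> \<rat>" by (intro Rats_add) auto
    then have "1 / x \<in> \<rat>" by (simp add: eq)
    then have "1 / (1 / x) \<in> \<rat>" by (rule Rats_divide[OF Rats_1])
    then show False using x by simp
  qed
  moreover have "gauss_map x \<in> {0..<1}" unfolding eq by (auto simp: floor_less_iff) linarith
  ultimately show "gauss_map x \<in> irrat" by (rule irratI[rotated])
  have "1 / x \<ge> 1" using x by simp
  then have fl: "\<lfloor>1 / x\<rfloor> \<ge> 1" by (simp add: le_floor_iff)
  then have "int (nat \<lfloor>1 / x\<rfloor>) = \<lfloor>1 / x\<rfloor>" by (intro nat_0_le) linarith
  then have nat_fl: "real (nat \<lfloor>1 / x\<rfloor>) = of_int \<lfloor>1 / x\<rfloor>"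
    by (metis of_int_of_nat_eq)
  then show "nat \<lfloor>1 / x\<rfloor> \<ge> 1" using nat_mono[OF fl] by (simp only: nat_1 One_nat_def)
  have "real (nat \<lfloor>1 / x\<rfloor>) + gauss_map x = 1 / x" by (simp add: eq nat_fl)
  then show "x = 1 / (real (nat \<lfloor>1 / x\<rfloor>) + gauss_map x)" by simp
qed

lemma gauss_map_branch:
  assumes "u \<in> irrat" and m: "m \<ge> 1"
  shows "1 / (real m + u) \<in> irrat" "gauss_map (1 / (real m + u)) = u" "nat \<lfloor>1 / (1 / (real m + u))\<rfloor> = m"
proof -
  have u: "0 < u" "u < 1" "u \<notin> \<rat>" using assms by (auto simp: irrat_def)
  have fl: "\<lfloor>real m + u\<rfloor> = int m" using u by (simp add: floor_eq_iff)
  show "gauss_map (1 / (real m + u)) = u" using u fl by (simp add: gauss_map_def)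
  show "nat \<lfloor>1 / (1 / (real m + u))\<rfloor> = m" using fl by simp
  have "1 / (real m + u) \<notin> \<rat>"
  proof
    assume "1 / (real m + u) \<in> \<rat>"
    then have "1 / (1 / (real m + u)) - real m \<in> \<rat>"
      by (rule Rats_diff[OF Rats_divide[OF Rats_1] Rats_of_nat])
    then show False using u by simp
  qed
  then show "1 / (real m + u) \<in> irrat" using u m by (auto simp: irrat_def divide_simps)
qed

lemma gauss_map_iterate_irrat: "x \<in> irrat \<Longrightarrow> (gauss_map ^^ n) x \<in> irrat"
  by (induction n) (auto intro: gauss_map_irrat)

lemma cf_digit_pos: "x \<in> irrat \<Longrightarrow> cf_digit x i \<ge> 1"
  unfolding cf_digit_def by (intro gauss_map_irrat gauss_map_iterate_irrat)

lemma cf_branch_cf_digit: "x \<in> irrat \<Longrightarrow> cf_branch (cf_digit x) n ((gauss_map ^^ n) x) = x"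
proof (induction n)
  case (Suc n)
  then show ?case
    using gauss_map_irrat(3)[OF gauss_map_iterate_irrat[OF Suc.prems, of n]] by (simp add: cf_digit_def)
qed simp

lemma cf_branch_irrat:
  assumes "u \<in> irrat" and "\<And>i. i \<in> {1..n} \<Longrightarrow> a i \<ge> 1"
  shows "cf_branch a n u \<in> irrat \<and> (gauss_map ^^ n) (cf_branch a n u) = u
    \<and> (\<forall>i\<in>{1..n}. cf_digit (cf_branch a n u) i = a i)"
  using assms
proof (induction n arbitrary: u)
  case (Suc n)
  let ?w = "1 / (real (a (Suc n)) + u)"
  have w: "?w \<in> irrat" "gauss_map ?w = u" "nat \<lfloor>1 / ?w\<rfloor> = a (Suc n)"
    using gauss_map_branch[OF Suc.prems(1), of "a (Suc n)"] Suc.prems(2)[of "Suc n"] by auto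
  have IH: "cf_branch a n ?w \<in> irrat" "(gauss_map ^^ n) (cf_branch a n ?w) = ?w"
    "\<forall>i\<in>{1..n}. cf_digit (cf_branch a n ?w) i = a i"
    using Suc.IH[OF w(1)] Suc.prems(2) by auto
  have "cf_digit (cf_branch a n ?w) (Suc n) = a (Suc n)"
    using IH(2) w(3) by (simp add: cf_digit_def)
  then have "\<forall>i\<in>{1..Suc n}. cf_digit (cf_branch a n ?w) i = a i"
    using IH(3) by (metis atLeastAtMost_iff le_Suc_eq)
  moreover have "(gauss_map ^^ Suc n) (cf_branch a n ?w) = u"
    unfolding funpow.simps o_apply IH(2) by (rule w(2))
  ultimately show ?case using IH(1) by simp
qed simp

section \<open>Measurability and the measure of cylinders\<close>

lemma borel_measurable_gauss_map [measurable]: "gauss_map \<in> borel_measurable borel"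
  unfolding gauss_map_def[abs_def] by measurable

lemma borel_measurable_gauss_map_iterate [measurable]: "gauss_map ^^ n \<in> borel_measurable borel"
proof (induction n)
  case (Suc n)
  then show ?case using measurable_comp[OF Suc borel_measurable_gauss_map] by simp
qed (simp add: id_def)

lemma borel_measurable_cf_digit [measurable]: "(\<lambda>x. real (cf_digit x n)) \<in> borel_measurable borel"
proof -
  have "(\<lambda>x. real (cf_digit x n)) = (\<lambda>x. max 0 (real_of_int \<lfloor>1 / (gauss_map ^^ (n - 1)) x\<rfloor>))"
    by (auto simp: cf_digit_def)
  then show ?thesis by simp
qed

lemma borel_measurable_cf_denom [measurable]: "(\<lambda>x. real (cf_denom (cf_digit x) n)) \<in> borel_measurable borel"
  by (induction n rule: induct_nat_012) auto

lemma sets_large_denom_set [simp]: "large_denom_set \<epsilon> n \<in> sets borel"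
proof -
  have "{x \<in> space borel. levy_const + \<epsilon> \<le> ln (real (cf_denom (cf_digit x) n)) / real n} \<in> sets borel"
    by (rule borel_measurable_le[OF borel_measurable_const
          borel_measurable_divide[OF borel_measurable_ln[OF borel_measurable_cf_denom] borel_measurable_const]])
  moreover have "(\<rat> :: real set) \<in> sets borel"
    by (rule sets.countable) (auto simp: countable_rat)
  ultimately have "({0..<1} - \<rat>) \<inter> {x \<in> space borel. levy_const + \<epsilon> \<le> ln (real (cf_denom (cf_digit x) n)) / real n} \<in> sets borel"
    by (intro sets.Int sets.Diff) simp_all
  also have "({0..<1} - \<rat>) \<inter> {x \<in> space borel. levy_const + \<epsilon> \<le> ln (real (cf_denom (cf_digit x) n)) / real n} = large_denom_set \<epsilon> n"
    unfolding large_denom_set_def by auto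
  finally show ?thesis .
qed

lemma mem_large_denom_set_iff:
  assumes "n \<ge> 1"
  shows "x \<in> large_denom_set \<epsilon> n \<longleftrightarrow>
    x \<in> irrat \<and> exp (real n * (levy_const + \<epsilon>)) \<le> real (cf_denom (cf_digit x) n)"
proof -
  have "x \<in> large_denom_set \<epsilon> n \<longleftrightarrow>
      x \<in> irrat \<and> levy_const + \<epsilon> \<le> ln (real (cf_denom (cf_digit x) n)) / real n"
    unfolding large_denom_set_def irrat_eq by simp
  also have "\<dots> \<longleftrightarrow> x \<in> irrat \<and> exp (real n * (levy_const + \<epsilon>)) \<le> real (cf_denom (cf_digit x) n)"
  proof (rule conj_cong[OF refl])
    assume x: "x \<in> irrat"
    have q: "0 < real (cf_denom (cf_digit x) n)"
      using cf_denom_pos[of n "cf_digit x"] cf_digit_pos[OF x] by simp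
    show "levy_const + \<epsilon> \<le> ln (real (cf_denom (cf_digit x) n)) / real n
        \<longleftrightarrow> exp (real n * (levy_const + \<epsilon>)) \<le> real (cf_denom (cf_digit x) n)"
      unfolding ln_ge_iff[OF q, symmetric] using assms by (subst pos_le_divide_eq) (simp_all add: mult.commute)
  qed
  finally show ?thesis .
qed

text \<open>Every point of the cylinder lies within \<open>1 / q^2\<close> of the endpoint
  \<open>cf_branch a n 0\<close>. The symmetric interval avoids distinguishing orientations by the
  parity of \<open>n\<close>; the resulting factor 2 disappears in the exponential rate.\<close>

lemma emeasure_cylinder_le:
  assumes a: "\<And>i. i \<in> {1..n} \<Longrightarrow> a i \<ge> 1"
    and X: "X \<subseteq> {x \<in> irrat. \<forall>i\<in>{1..n}. cf_digit x i = a i}"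
  shows "emeasure lborel X \<le> ennreal (2 / (real (cf_denom a n))\<^sup>2)"
proof -
  let ?c = "cf_branch a n 0" and ?d = "1 / (real (cf_denom a n))\<^sup>2"
  have "X \<subseteq> {?c - ?d..?c + ?d}"
  proof
    fix x assume "x \<in> X"
    then have x: "x \<in> irrat" "\<forall>i\<in>{1..n}. cf_digit x i = a i" using X by auto
    define u where "u = (gauss_map ^^ n) x"
    have u: "u \<in> {0..1}" using gauss_map_iterate_irrat[OF x(1), of n] by (auto simp: irrat_def u_def)
    have "cf_branch (cf_digit x) n u = cf_branch a n u"
      by (rule cf_branch_cong) (use x(2) in auto)
    moreover have "cf_branch (cf_digit x) n u = x"
      unfolding u_def by (rule cf_branch_cf_digit[OF x(1)])
    ultimately have "cf_branch a n u = x" by simp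
    then have "\<bar>x - ?c\<bar> \<le> \<bar>u - 0\<bar> / (real (cf_denom a n))\<^sup>2"
      using cf_branch_diff_le[of n a u 0] a u by simp
    also have "\<dots> \<le> ?d" using u by (intro divide_right_mono) auto
    finally show "x \<in> {?c - ?d..?c + ?d}" by (auto simp: abs_le_iff)
  qed
  then have "emeasure lborel X \<le> emeasure lborel {?c - ?d..?c + ?d}"
    by (intro emeasure_mono) auto
  also have "\<dots> = ennreal (2 / (real (cf_denom a n))\<^sup>2)"
    by (subst emeasure_lborel_Icc) auto
  finally show ?thesis .
qed

lemma countable_tuples: "countable (tuples n)"
  by (intro countable_PiE) auto

text \<open>On each cylinder meeting the set, split \<open>q powr (-2)\<close> into
  \<open>q powr (-t)\<close>, at most \<open>exp (- t n (b + \<epsilon>))\<close>, and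
  \<open>q powr (-(2 - t))\<close>, which is summed over all digit tuples.\<close>

lemma measure_large_denom_set_le:
  assumes n: "n \<ge> 1" and t: "t \<in> {0<..<1}" and pos: "levy_const + \<epsilon> \<ge> 0"
  shows "measure lebesgue (large_denom_set \<epsilon> n)
    \<le> 2 * exp (- t * real n * (levy_const + \<epsilon>)) * denom_sum (2 - t) n 0"
proof -
  let ?A = "large_denom_set \<epsilon> n"
  let ?E = "exp (real n * (levy_const + \<epsilon>))"
  define I where "I a = {x \<in> ?A. \<forall>i\<in>{1..n}. real (cf_digit x i) = real (a i)}" for a
  define w where "w a = 2 * exp (- t * real n * (levy_const + \<epsilon>)) * real (cf_denom a n) powr (-(2 - t))" for a
  have A_irrat: "x \<in> irrat" if "x \<in> ?A" for x
    using that unfolding mem_large_denom_set_iff[OF n] by (rule conjunct1)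
  have I_sets: "I a \<in> sets lborel" for a
  proof -
    have "{x \<in> space borel. real (cf_digit x i) = real (a i)} \<in> sets borel" for i
      by (rule borel_measurable_eq[OF borel_measurable_cf_digit borel_measurable_const])
    then have "?A \<inter> (\<Inter>i\<in>{1..n}. {x \<in> space borel. real (cf_digit x i) = real (a i)}) \<in> sets borel"
      using n by (intro sets.Int sets.finite_INT) auto
    also have "?A \<inter> (\<Inter>i\<in>{1..n}. {x \<in> space borel. real (cf_digit x i) = real (a i)}) = I a"
      by (auto simp: I_def)
    finally show ?thesis by simp
  qed
  have digits: "a i \<ge> 1" if "a \<in> tuples n" "i \<in> {1..n}" for a i
    using that by (auto simp: PiE_iff)
  have disj: "disjoint_family_on I (tuples n)"
  proof (unfold disjoint_family_on_def, intro ballI impI)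
    fix a b assume ab: "a \<in> tuples n" "b \<in> tuples n" "a \<noteq> b"
    show "I a \<inter> I b = {}"
    proof (rule ccontr)
      assume "I a \<inter> I b \<noteq> {}"
      then obtain x where "x \<in> I a" "x \<in> I b" by blast
      then have "real (a i) = real (b i)" if "i \<in> {1..n}" for i
        using that by (metis (mono_tags, lifting) I_def mem_Collect_eq)
      then have "a i = b i" if "i \<in> {1..n}" for i using that by simp
      then have "a = b" using ab by (intro PiE_ext) auto
      then show False using ab by simp
    qed
  qed
  have union: "?A = (\<Union>a\<in>tuples n. I a)"
  proof
    show "?A \<subseteq> (\<Union>a\<in>tuples n. I a)"
    proof
      fix x assume x: "x \<in> ?A"
      have "x \<in> I (restrict (cf_digit x) {1..n})" using x by (auto simp: I_def)
      moreover have "restrict (cf_digit x) {1..n} \<in> tuples n"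
        using cf_digit_pos[OF A_irrat[OF x]] by auto
      ultimately show "x \<in> (\<Union>a\<in>tuples n. I a)" by blast
    qed
  qed (auto simp: I_def)
  have bound: "emeasure lborel (I a) \<le> ennreal (w a)" if a: "a \<in> tuples n" for a
  \<comment> \<open>The lower bound on the denominator is read off from a point of the cell; an
    empty cell has measure 0.\<close>
  proof (cases "I a = {}")
    case False
    then obtain x where x: "x \<in> ?A" "\<forall>i\<in>{1..n}. cf_digit x i = a i" by (auto simp: I_def)
    have "cf_denom (cf_digit x) n = cf_denom a n" using x(2) by (intro cf_denom_cong) auto
    moreover have "?E \<le> real (cf_denom (cf_digit x) n)"
      using x(1) unfolding mem_large_denom_set_iff[OF n] by (rule conjunct2)
    ultimately have q: "?E \<le> real (cf_denom a n)" by simp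
    have q0: "real (cf_denom a n) > 0" using less_le_trans[OF exp_gt_zero q] .
    have "real (cf_denom a n) powr (- t) \<le> ?E powr (- t)"
      using q t by (intro powr_mono2') auto
    also have "\<dots> = exp (- t * real n * (levy_const + \<epsilon>))"
      by (simp add: powr_def mult_ac)
    finally have le: "real (cf_denom a n) powr (- t) \<le> exp (- t * real n * (levy_const + \<epsilon>))" .
    have "emeasure lborel (I a) \<le> ennreal (2 / (real (cf_denom a n))\<^sup>2)"
      by (rule emeasure_cylinder_le[OF digits[OF a]]) (auto simp: I_def A_irrat)
    also have "2 / (real (cf_denom a n))\<^sup>2 = 2 * (real (cf_denom a n) powr (- t) * real (cf_denom a n) powr (-(2 - t)))"
    proof -
      have "real (cf_denom a n) powr (- t) * real (cf_denom a n) powr (-(2 - t)) = real (cf_denom a n) powr (-2)"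
        by (simp flip: powr_add)
      also have "\<dots> = 1 / (real (cf_denom a n))\<^sup>2"
        using q0 by (simp add: powr_minus powr_numeral divide_inverse)
      finally show ?thesis by simp
    qed
    also have "\<dots> \<le> 2 * (exp (- t * real n * (levy_const + \<epsilon>)) * real (cf_denom a n) powr (-(2 - t)))"
      using le by (intro mult_left_mono mult_right_mono) auto
    also have "\<dots> = w a" by (simp add: w_def)
    finally show ?thesis by (auto intro: ennreal_leI)
  qed simp
  have wsum: "(w has_sum (2 * exp (- t * real n * (levy_const + \<epsilon>)) * denom_sum (2 - t) n 0)) (tuples n)"
    unfolding w_def using has_sum_denom_sum[of "2 - t" 0 n] t by (intro has_sum_cmult_right) auto
  have w0: "w a \<ge> 0" for a by (simp add: w_def)
  have wabs: "Infinite_Set_Sum.abs_summable_on w (tuples n)"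
    using wsum w0 by (subst abs_summable_equivalent[symmetric]) (auto simp: summable_on_def)
  have "emeasure lborel ?A = (\<integral>\<^sup>+a. emeasure lborel (I a) \<partial>count_space (tuples n))"
    unfolding union by (rule emeasure_UN_countable[OF I_sets countable_tuples disj])
  also have "\<dots> \<le> (\<integral>\<^sup>+a. ennreal (w a) \<partial>count_space (tuples n))"
    by (rule nn_integral_mono) (simp only: space_count_space bound)
  also have "\<dots> = ennreal (infsetsum w (tuples n))"
    by (rule nn_integral_conv_infsetsum[OF wabs w0])
  also have "infsetsum w (tuples n) = infsum w (tuples n)"
    by (rule infsetsum_infsum[OF wabs])
  also have "\<dots> = 2 * exp (- t * real n * (levy_const + \<epsilon>)) * denom_sum (2 - t) n 0"
    by (rule infsumI[OF wsum])
  finally have "emeasure lborel ?A \<le> ennreal (2 * exp (- t * real n * (levy_const + \<epsilon>)) * denom_sum (2 - t) n 0)" .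
  moreover have "denom_sum (2 - t) n 0 \<ge> 0" using denom_sum_nonneg[of "2 - t" 0 n] t by simp
  moreover have "measure lebesgue ?A = measure lborel ?A"
    by (rule measure_completion) simp
  ultimately show ?thesis by (simp add: measure_def enn2real_leI)
qed

lemma cf_denom_const_ge: "m ^ n \<le> cf_denom (\<lambda>_. m) n"
proof (induction n)
  case (Suc n)
  then have "m * m ^ n \<le> m * cf_denom (\<lambda>_. m) n" by (intro mult_left_mono) auto
  then show ?case unfolding cf_denom_Suc power_Suc by linarith
qed simp

text \<open>\<open>\<surd>3 m\<close> dominates the root \<open>r\<close> of \<open>r\<^sup>2 = m r + 1\<close>, which is the growth rate of the denominators.\<close>

lemma cf_denom_const_le:
  assumes m: "m \<ge> 1"
  shows "real (cf_denom (\<lambda>_. m) n) \<le> (sqrt 3 * real m) ^ n"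
proof (induction n rule: induct_nat_012)
  case 1
  have "1 * real m \<le> sqrt 3 * real m" by (intro mult_right_mono) auto
  then show ?case by simp
next
  case (ge2 n)
  let ?r = "sqrt 3 * real m"
  have s3: "sqrt 3 \<le> (2::real)" by (rule real_le_lsqrt) auto
  have "sqrt 3 * (real m)\<^sup>2 + 1 \<le> 2 * (real m)\<^sup>2 + (real m)\<^sup>2"
    using s3 m by (intro add_mono mult_right_mono) auto
  then have r: "real m * ?r + 1 \<le> ?r\<^sup>2"
    by (simp add: power_mult_distrib power2_eq_square mult_ac)
  have "real (cf_denom (\<lambda>_. m) (Suc (Suc n))) \<le> real m * ?r ^ Suc n + ?r ^ n"
    using mult_left_mono[OF ge2(2), of "real m"] ge2(1) by simp
  also have "\<dots> = (real m * ?r + 1) * ?r ^ n" by (simp add: algebra_simps)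
  also have "\<dots> \<le> ?r\<^sup>2 * ?r ^ n" using r by (intro mult_right_mono) auto
  finally show ?case by (simp only: power2_eq_square power_Suc mult.assoc)
qed simp

text \<open>The cylinder with constant digit \<open>m\<close> lies in the set up to rationals
  because \<open>q \<ge> m ^ n\<close>. Its length is at least \<open>1 / (2 * q^2)\<close>, and
  \<open>q \<le> (sqrt 3 * m) ^ n\<close> produces the \<open>ln 3\<close> of the final
  bound.\<close>

lemma measure_large_denom_set_ge:
  assumes n: "n \<ge> 1" and m: "exp (levy_const + \<epsilon>) \<le> real m"
  shows "1 / (2 * (3 * (real m)\<^sup>2) ^ n) \<le> measure lebesgue (large_denom_set \<epsilon> n)"
proof -
  let ?A = "large_denom_set \<epsilon> n"
  let ?a = "\<lambda>_::nat. m"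
  have m1: "m \<ge> 1" using less_le_trans[OF exp_gt_zero m] by simp
  define l r where "l = min (cf_branch ?a n 0) (cf_branch ?a n 1)"
    and "r = max (cf_branch ?a n 0) (cf_branch ?a n 1)"
  let ?q = "real (cf_denom ?a n)" and ?p = "real (cf_denom_prev ?a n)"
  have q: "?q \<ge> 1" using cf_denom_pos[of n ?a] m1 by simp
  have p: "?p \<le> ?q" using cf_denom_prev_le[of n ?a] m1 by simp
  have E: "exp (real n * (levy_const + \<epsilon>)) \<le> ?q"
  proof -
    have "exp (real n * (levy_const + \<epsilon>)) = exp (levy_const + \<epsilon>) ^ n" by (simp add: exp_of_nat_mult)
    also have "\<dots> \<le> real m ^ n" using m by (intro power_mono) auto
    also have "\<dots> \<le> ?q" using cf_denom_const_ge[of m n] by (simp flip: of_nat_power)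
    finally show ?thesis .
  qed
  have cont: "continuous_on {0..1} (cf_branch ?a n)"
  proof (rule lipschitz_on_continuous_on[of 1], rule lipschitz_onI)
    fix u v :: real assume uv: "u \<in> {0..1}" "v \<in> {0..1}"
    have "\<bar>cf_branch ?a n u - cf_branch ?a n v\<bar> \<le> \<bar>u - v\<bar> / ?q\<^sup>2"
      using uv m1 by (intro cf_branch_diff_le) auto
    also have "\<dots> \<le> \<bar>u - v\<bar> / 1" using q by (intro divide_left_mono) (auto simp: one_le_power)
    finally show "dist (cf_branch ?a n u) (cf_branch ?a n v) \<le> 1 * dist u v" by (simp add: dist_real_def)
  qed simp
  \<comment> \<open>By connectedness the branch takes every value between its endpoint values. An
    irrational value has an irrational preimage, so its digits are the prescribed ones.\<close>
  have sub: "{l<..<r} - \<rat> \<subseteq> ?A"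
  proof
    fix y assume y: "y \<in> {l<..<r} - \<rat>"
    have "connected (cf_branch ?a n ` {0..1})" by (intro connected_continuous_image cont connected_Icc)
    moreover have "l \<in> cf_branch ?a n ` {0..1}" "r \<in> cf_branch ?a n ` {0..1}"
      unfolding l_def r_def min_def max_def by auto
    ultimately have "y \<in> cf_branch ?a n ` {0..1}" using connectedD_interval y by fastforce
    then obtain u where u: "u \<in> {0..1}" "y = cf_branch ?a n u" by blast
    have "u \<notin> \<rat>" using u y cf_branch_Rats by blast
    moreover have "u \<noteq> 1" using calculation by auto
    ultimately have "u \<in> irrat" using u by (intro irratI) auto
    then have "y \<in> irrat" "\<forall>i\<in>{1..n}. cf_digit y i = m"
      using cf_branch_irrat[of u n ?a] m1 u by auto
    moreover from this have "cf_denom (cf_digit y) n = cf_denom ?a n" by (intro cf_denom_cong) auto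
    ultimately show "y \<in> ?A" using E mem_large_denom_set_iff[OF n] by simp
  qed
  have "r - l = \<bar>cf_branch ?a n 0 - cf_branch ?a n 1\<bar>" by (auto simp: l_def r_def)
  also have "\<dots> = 1 / (?q * (?q + ?p))"
    using cf_branch_diff[of n ?a 0 1] m1 by simp
  finally have len: "r - l = 1 / (?q * (?q + ?p))" .
  have "1 / (2 * (3 * (real m)\<^sup>2) ^ n) = 1 / (2 * ((sqrt 3 * real m) ^ n)\<^sup>2)"
    by (simp add: power_mult_distrib flip: power_mult) (simp add: power_mult mult.commute[of n 2])
  also have "\<dots> \<le> 1 / (2 * ?q\<^sup>2)"
    using cf_denom_const_le[OF m1, of n] q m1
    by (intro divide_left_mono mult_left_mono power_mono mult_pos_pos zero_less_power) auto
  also have "\<dots> \<le> r - l"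
  proof -
    have "?q * (?q + ?p) \<le> 2 * ?q\<^sup>2"
      using mult_left_mono[OF p, of ?q] by (simp add: power2_eq_square distrib_left)
    moreover have "0 < ?q * (?q + ?p)"
      using q by (intro mult_pos_pos add_pos_nonneg) auto
    ultimately show ?thesis unfolding len by (intro frac_le) auto
  qed
  finally have rl: "1 / (2 * (3 * (real m)\<^sup>2) ^ n) \<le> r - l" .
  have rat: "(\<rat> :: real set) \<in> null_sets lborel" by (intro countable_imp_null_set_lborel countable_rat)
  have "emeasure lborel ({l<..<r} - \<rat>) = ennreal (r - l)"
    using emeasure_Diff_null_set[OF rat, of "{l<..<r}"] by (simp add: l_def r_def)
  then have "ennreal (r - l) \<le> emeasure lborel ?A"
    using emeasure_mono[OF sub, of lborel] by simp
  moreover have "emeasure lborel ?A \<noteq> \<infinity>"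
  proof -
    have "emeasure lborel ?A \<le> emeasure lborel {0..1::real}"
      by (intro emeasure_mono) (auto simp: large_denom_set_def)
    then show ?thesis by (auto simp: top_unique)
  qed
  ultimately have "r - l \<le> measure lborel ?A"
    by (simp add: emeasure_eq_ennreal_measure)
  moreover have "measure lebesgue ?A = measure lborel ?A"
    by (rule measure_completion) simp
  ultimately show ?thesis using rl by simp
qed

section \<open>Large deviations\<close>

lemma limsup_log_prob_rate_le:
  assumes \<epsilon>: "\<epsilon> > 0" and t: "t \<in> {0<..<1}"
  shows "limsup (log_prob_rate \<epsilon>) \<le> ereal (- t * (levy_const + \<epsilon>) + dioph_pressure (1 - t / 2))"
proof -
  let ?F = "\<lambda>n. denom_sum (2 * (1 - t / 2)) n 0"
  let ?f = "\<lambda>n. ln 2 / real n - t * (levy_const + \<epsilon>) + ln (?F n) / real n"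
  have s: "2 * (1 - t / 2) = 2 - t" by simp
  have F: "?F n > 0" for n using t by (intro denom_sum_pos) auto
  have "(\<lambda>n. ln 2 / real n - t * (levy_const + \<epsilon>)) \<longlonglongrightarrow> - t * (levy_const + \<epsilon>)"
    by real_asymp
  then have "?f \<longlonglongrightarrow> - t * (levy_const + \<epsilon>) + dioph_pressure (1 - t / 2)"
    using t by (intro tendsto_add tendsto_dioph_pressure) auto
  then have "limsup (\<lambda>n. ereal (?f n)) = ereal (- t * (levy_const + \<epsilon>) + dioph_pressure (1 - t / 2))"
    by (intro lim_imp_Limsup) auto
  moreover have "limsup (log_prob_rate \<epsilon>) \<le> limsup (\<lambda>n. ereal (?f n))"
  proof (rule Limsup_mono, rule eventually_sequentiallyI[of 1])
    fix n :: nat assume n: "n \<ge> 1"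
    let ?m = "measure lebesgue (large_denom_set \<epsilon> n)"
    show "log_prob_rate \<epsilon> n \<le> ereal (?f n)"
    \<comment> \<open>A null set has rate \<open>-\<infinity>\<close> by the convention of
      \<open>ext_ln\<close>, so the bound is trivial there.\<close>
    proof (cases "?m = 0")
      case True
      then show ?thesis using n by (simp add: log_prob_rate_def ext_ln_def)
    next
      case False
      then have m: "?m > 0" using measure_nonneg[of lebesgue "large_denom_set \<epsilon> n"] by linarith
      have "?m \<le> 2 * exp (- t * real n * (levy_const + \<epsilon>)) * ?F n"
        unfolding s using \<epsilon> levy_const_pos by (intro measure_large_denom_set_le n t) auto
      then have "ln ?m \<le> ln (2 * exp (- t * real n * (levy_const + \<epsilon>)) * ?F n)"
        using m by (intro ln_mono) auto
      also have "\<dots> = ln 2 + - t * real n * (levy_const + \<epsilon>) + ln (?F n)"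
        using F[of n] by (simp add: ln_mult_pos)
      finally have "ln ?m / real n \<le> (ln 2 + - t * real n * (levy_const + \<epsilon>) + ln (?F n)) / real n"
        by (rule divide_right_mono) simp
      also have "\<dots> = ?f n" using n by (simp add: field_simps)
      finally show ?thesis using False by (simp add: log_prob_rate_def ext_ln_def)
    qed
  qed
  ultimately show ?thesis by simp
qed

lemma liminf_log_prob_rate_ge:
  assumes m: "exp (levy_const + \<epsilon>) \<le> real m"
  shows "ereal (- 2 * ln (real m) - ln 3) \<le> liminf (log_prob_rate \<epsilon>)"
proof -
  let ?f = "\<lambda>n. - ln 2 / real n - 2 * ln (real m) - ln 3"
  have m0: "real m > 0" using less_le_trans[OF exp_gt_zero m] .
  have "?f \<longlonglongrightarrow> - 2 * ln (real m) - ln 3" by real_asymp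
  then have "liminf (\<lambda>n. ereal (?f n)) = ereal (- 2 * ln (real m) - ln 3)"
    by (intro lim_imp_Liminf) auto
  moreover have "liminf (\<lambda>n. ereal (?f n)) \<le> liminf (log_prob_rate \<epsilon>)"
  proof (rule Liminf_mono, rule eventually_sequentiallyI[of 1])
    fix n :: nat assume n: "n \<ge> 1"
    let ?m = "measure lebesgue (large_denom_set \<epsilon> n)"
    have le: "1 / (2 * (3 * (real m)\<^sup>2) ^ n) \<le> ?m" by (rule measure_large_denom_set_ge[OF n m])
    have pos: "0 < 1 / (2 * (3 * (real m)\<^sup>2) ^ n)" using m0 by simp
    have "ln (1 / (2 * (3 * (real m)\<^sup>2) ^ n)) = - ln 2 - real n * (2 * ln (real m) + ln 3)"
      using m0 by (simp add: ln_div ln_mult_pos ln_realpow algebra_simps)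
    moreover have "ln (1 / (2 * (3 * (real m)\<^sup>2) ^ n)) \<le> ln ?m" using le pos by (intro ln_mono) auto
    ultimately have "(- ln 2 - real n * (2 * ln (real m) + ln 3)) / real n \<le> ln ?m / real n"
      by (intro divide_right_mono) auto
    moreover have "(- ln 2 - real n * (2 * ln (real m) + ln 3)) / real n = ?f n"
      using n by (simp add: field_simps)
    moreover have "?m \<noteq> 0" using le pos by linarith
    ultimately show "ereal (?f n) \<le> log_prob_rate \<epsilon> n"
      by (simp add: log_prob_rate_def ext_ln_def)
  qed
  ultimately show ?thesis by simp
qed

theorem theorem2p1:
  fixes \<epsilon> :: real
  assumes "\<epsilon> > 0"
  shows "limsup (log_prob_rate \<epsilon>) \<le> ereal (theta1 \<epsilon>)
    \<and> theta1 \<epsilon> < 0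
    \<and> liminf (log_prob_rate \<epsilon>)
        \<ge> ereal (- 2 * ln (of_int \<lceil>exp (levy_const + \<epsilon>)\<rceil>) - ln 3)"
proof (intro conjI)
  let ?g = "\<lambda>t. - t * (levy_const + \<epsilon>) + dioph_pressure (1 - t / 2)"
  define m where "m = nat \<lceil>exp (levy_const + \<epsilon>)\<rceil>"
  have ceil: "real_of_int \<lceil>exp (levy_const + \<epsilon>)\<rceil> = real m"
    by (simp add: m_def)
  have m: "exp (levy_const + \<epsilon>) \<le> real m"
    unfolding ceil[symmetric] by (rule le_of_int_ceiling)
  show lower: "liminf (log_prob_rate \<epsilon>) \<ge> ereal (- 2 * ln (of_int \<lceil>exp (levy_const + \<epsilon>)\<rceil>) - ln 3)"
    unfolding ceil by (rule liminf_log_prob_rate_ge[OF m])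
  \<comment> \<open>The lower bound on the probabilities, passed through the limsup, bounds the
    pressure expression below for every \<open>t\<close>. The real infimum in \<open>theta1\<close>
    is thereby a genuine one.\<close>
  have "ereal (- 2 * ln (real m) - ln 3) \<le> limsup (log_prob_rate \<epsilon>)"
    using lower[unfolded ceil] Liminf_le_Limsup[of sequentially "log_prob_rate \<epsilon>"]
    by (auto intro: order_trans)
  moreover note upper = limsup_log_prob_rate_le[OF assms]
  ultimately have "ereal (- 2 * ln (real m) - ln 3) \<le> ereal (?g t)" if "t \<in> {0<..<1}" for t
    using that by (blast intro: order_trans)
  then have bdd: "bdd_below (?g ` {0<..<1})"
    by (intro bdd_belowI2[of _ "- 2 * ln (real m) - ln 3"]) (simp only: ereal_less_eq)
  obtain l where l: "limsup (log_prob_rate \<epsilon>) = ereal l"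
    using \<open>ereal (- 2 * ln (real m) - ln 3) \<le> limsup (log_prob_rate \<epsilon>)\<close> upper[of "1 / 2"]
    by (cases "limsup (log_prob_rate \<epsilon>)") auto
  have "l \<le> theta1 \<epsilon>"
    unfolding theta1_def
  proof (rule cINF_greatest)
    show "l \<le> ?g t" if "t \<in> {0<..<1}" for t
      using upper[OF that] unfolding l by (simp only: ereal_less_eq)
  qed simp
  then show "limsup (log_prob_rate \<epsilon>) \<le> ereal (theta1 \<epsilon>)"
    unfolding l by simp
  \<comment> \<open>Taking half of \<open>\<epsilon>\<close> in the pressure bound leaves a negative
    margin of \<open>t * \<epsilon> / 2\<close>.\<close>
  obtain t where t: "t \<in> {0<..<1}" "dioph_pressure (1 - t / 2) \<le> t * (levy_const + \<epsilon> / 2)"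
    using dioph_pressure_le[of "\<epsilon> / 2"] assms by auto
  have "theta1 \<epsilon> \<le> ?g t"
    unfolding theta1_def by (rule cINF_lower[OF bdd t(1)])
  also have "\<dots> \<le> - (t * (\<epsilon> / 2))"
    using t(2) by (simp add: algebra_simps)
  also have "\<dots> < 0" using t(1) assms by simp
  finally show "theta1 \<epsilon> < 0" .
qed

end
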